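(* Let $F$ be an algebraically closed field of characteristic $2$, let $\tilde G=\langle\sigma_1,\sigma_2\rangle$ be the Klein four group, and let $V$ be a non-trivial representation of $\tilde G$ over $F$. Consider the decomposition of $V$ into indecomposable summands. Then $\delta(\tilde G,V)=\gamma(\tilde G,V)=2$ if and only if every non-trivial indecomposable summand is isomorphic to one of $V_{2,0}$, $V_{2,1}$, $W_2$ or $W_{2m+1}$ $(m\ge 1)$. If another non-trivial indecomposable summand appears, then $\delta(\tilde G,V)=\gamma(\tilde G,V)=4$.
   Context: Representations are finite dimensional over $F$. A finite group $G$ acts on the polynomial ring $F[V]$ by $\tau(f)=f\circ\tau^{-1}$; $F[V]^G_d$ is the space of homogeneous invariants of degree $d$; $V^G$ is the space of fixed points. For $v\in V\setminus\{0\}$ put $\epsilon(G,v)=\min\{d>0\mid \text{there is } f\in F[V]^G_d \text{ with } f(v)\ne 0\}$. Then $\gamma(G,V)$ is the supremum of $\epsilon(G,v)$ over all $v\in V\setminus\{0\}$, and $\delta(G,V)$ is $0$ if $V^G=\{0\}$ and otherwise the supremum of $\epsilon(G,v)$ over all $v\in V^G\setminus\{0\}$. A representation is non-trivial if the group does not act trivially on it. The following $\tilde G$-modules are used. For $\lambda\in F$, $V_{2,\lambda}$ is the $2$-dimensional module with basis $e,h$ and action $\sigma_1(e)=\sigma_2(e)=e$, $\sigma_1(h)=h+e$, $\sigma_2(h)=h+\lambda e$. $W_2$ is obtained from $V_{2,0}$ by interchanging the actions of $\sigma_1$ and $\sigma_2$, i.e. it has basis $e,h$ with $\sigma_1(e)=\sigma_2(e)=e$,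 $\sigma_1(h)=h$, $\sigma_2(h)=h+e$. For $m\ge 1$, $W_{2m+1}$ is the $(2m+1)$-dimensional module (of column vectors $F^{2m+1}$) afforded by \[ \sigma_1\mapsto\begin{pmatrix} I_{m+1} & A\\ 0& I_m\end{pmatrix},\qquad \sigma_2\mapsto\begin{pmatrix} I_{m+1} & B\\ 0& I_m\end{pmatrix}, \] where $A=\begin{pmatrix} I_m\\ 0_{1\times m}\end{pmatrix}$ and $B=\begin{pmatrix} 0_{1\times m}\\ I_m\end{pmatrix}$ are $(m+1)\times m$ matrices. All these modules are indecomposable. *)

theory Defs
  imports
    "HOL-Computational_Algebra.Polynomial"
    "HOL-Algebra.Generated_Groups"
    "HOL-Library.Extended_Nat"
    "Jordan_Normal_Form.Matrix"
begin

definition klein_four_group :: "('g, 'm) monoid_scheme \<Rightarrow> 'g \<Rightarrow> 'g \<Rightarrow> bool" where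
  "klein_four_group G \<sigma>1 \<sigma>2 \<longleftrightarrow>
     group G \<and> order G = 4 \<and> (\<forall>g\<in>carrier G. g \<otimes>\<^bsub>G\<^esub> g = \<one>\<^bsub>G\<^esub>) \<and>
     \<sigma>1 \<in> carrier G \<and> \<sigma>2 \<in> carrier G \<and> generate G {\<sigma>1, \<sigma>2} = carrier G"

text \<open>The representation space is the whole type \<open>'v\<close>, with scalar multiplication \<open>scale\<close>.\<close>

definition representation ::
  "('g, 'm) monoid_scheme \<Rightarrow> ('a::field \<Rightarrow> 'v::ab_group_add \<Rightarrow> 'v) \<Rightarrow> ('g \<Rightarrow> 'v \<Rightarrow> 'v) \<Rightarrow> bool" where
  "representation G scale \<rho> \<longleftrightarrow>
     vector_space scale \<and> (\<exists>B. finite B \<and> module.span scale B = UNIV) \<and>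
     (\<forall>g\<in>carrier G. Vector_Spaces.linear scale scale (\<rho> g)) \<and>
     \<rho> \<one>\<^bsub>G\<^esub> = id \<and>
     (\<forall>g\<in>carrier G. \<forall>h\<in>carrier G. \<rho> (g \<otimes>\<^bsub>G\<^esub> h) = \<rho> g \<circ> \<rho> h)"

definition fixed_points :: "('g, 'm) monoid_scheme \<Rightarrow> ('g \<Rightarrow> 'v \<Rightarrow> 'v) \<Rightarrow> 'v set" where
  "fixed_points G \<rho> = {v. \<forall>g\<in>carrier G. \<rho> g v = v}"

text \<open>The homogeneous part of degree \<open>d\<close> of \<open>F[V]\<close>: linear combinations of products of \<open>d\<close>
  linear forms, taken as functions on \<open>V\<close>. This agrees with formal polynomials because it is
  used only over an algebraically closed, hence infinite, field.\<close>

definition homogeneous_poly ::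
  "('a::field \<Rightarrow> 'v::ab_group_add \<Rightarrow> 'v) \<Rightarrow> nat \<Rightarrow> ('v \<Rightarrow> 'a) set" where
  "homogeneous_poly scale d =
     {f. \<exists>(n::nat) c l. (\<forall>k<n. \<forall>i<d. Vector_Spaces.linear scale (*) (l k i)) \<and>
           f = (\<lambda>v. \<Sum>k<n. c k * (\<Prod>i<d. l k i v))}"

definition invariants ::
  "('g, 'm) monoid_scheme \<Rightarrow> ('a::field \<Rightarrow> 'v::ab_group_add \<Rightarrow> 'v) \<Rightarrow> ('g \<Rightarrow> 'v \<Rightarrow> 'v) \<Rightarrow> nat
     \<Rightarrow> ('v \<Rightarrow> 'a) set" where
  "invariants G scale \<rho> d =
     {f \<in> homogeneous_poly scale d. \<forall>g\<in>carrier G. f \<circ> \<rho> (inv\<^bsub>G\<^esub> g) = f}"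

text \<open>The values lie in \<open>enat\<close>, so that an infimum over the empty set and an unbounded supremum
  would both be \<open>\<infinity>\<close>, while a supremum over the empty set is \<open>0\<close>.\<close>

definition epsilon ::
  "('g, 'm) monoid_scheme \<Rightarrow> ('a::field \<Rightarrow> 'v::ab_group_add \<Rightarrow> 'v) \<Rightarrow> ('g \<Rightarrow> 'v \<Rightarrow> 'v) \<Rightarrow> 'v \<Rightarrow> enat" where
  "epsilon G scale \<rho> v = Inf {enat d |d. d > 0 \<and> (\<exists>f\<in>invariants G scale \<rho> d. f v \<noteq> 0)}"

definition gamma ::
  "('g, 'm) monoid_scheme \<Rightarrow> ('a::field \<Rightarrow> 'v::ab_group_add \<Rightarrow> 'v) \<Rightarrow> ('g \<Rightarrow> 'v \<Rightarrow> 'v) \<Rightarrow> enat" where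
  "gamma G scale \<rho> = (SUP v\<in>UNIV - {0}. epsilon G scale \<rho> v)"

definition delta ::
  "('g, 'm) monoid_scheme \<Rightarrow> ('a::field \<Rightarrow> 'v::ab_group_add \<Rightarrow> 'v) \<Rightarrow> ('g \<Rightarrow> 'v \<Rightarrow> 'v) \<Rightarrow> enat" where
  "delta G scale \<rho> =
     (if fixed_points G \<rho> = {0} then 0 else SUP v\<in>fixed_points G \<rho> - {0}. epsilon G scale \<rho> v)"

definition subrep ::
  "('g, 'm) monoid_scheme \<Rightarrow> ('a::field \<Rightarrow> 'v::ab_group_add \<Rightarrow> 'v) \<Rightarrow> ('g \<Rightarrow> 'v \<Rightarrow> 'v) \<Rightarrow> 'v set \<Rightarrow> bool" where
  "subrep G scale \<rho> U \<longleftrightarrow> module.subspace scale U \<and> (\<forall>g\<in>carrier G. \<rho> g ` U \<subseteq> U)"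

definition nontrivial_on :: "('g, 'm) monoid_scheme \<Rightarrow> ('g \<Rightarrow> 'v \<Rightarrow> 'v) \<Rightarrow> 'v set \<Rightarrow> bool" where
  "nontrivial_on G \<rho> U \<longleftrightarrow> (\<exists>g\<in>carrier G. \<exists>x\<in>U. \<rho> g x \<noteq> x)"

definition indecomposable ::
  "('g, 'm) monoid_scheme \<Rightarrow> ('a::field \<Rightarrow> 'v::ab_group_add \<Rightarrow> 'v) \<Rightarrow> ('g \<Rightarrow> 'v \<Rightarrow> 'v) \<Rightarrow> 'v set \<Rightarrow> bool" where
  "indecomposable G scale \<rho> U \<longleftrightarrow>
     subrep G scale \<rho> U \<and> U \<noteq> {0} \<and>
     (\<forall>A B. subrep G scale \<rho> A \<and> subrep G scale \<rho> B \<and>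
            {a + b |a b. a \<in> A \<and> b \<in> B} = U \<and> A \<inter> B = {0} \<longrightarrow> A = {0} \<or> B = {0})"

definition indecomposable_decomposition ::
  "('g, 'm) monoid_scheme \<Rightarrow> ('a::field \<Rightarrow> 'v::ab_group_add \<Rightarrow> 'v) \<Rightarrow> ('g \<Rightarrow> 'v \<Rightarrow> 'v)
     \<Rightarrow> nat \<Rightarrow> (nat \<Rightarrow> 'v set) \<Rightarrow> bool" where
  "indecomposable_decomposition G scale \<rho> k U \<longleftrightarrow>
     (\<forall>i<k. indecomposable G scale \<rho> (U i)) \<and>
     (\<forall>v. \<exists>!u. u \<in> (\<Pi>\<^sub>E i\<in>{..<k}. U i) \<and> v = (\<Sum>i<k. u i))"

text \<open>A module for the Klein four group is given on column vectors by the pair of square matrices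
  through which \<open>\<sigma>1\<close> and \<open>\<sigma>2\<close> act. As \<open>\<sigma>1\<close> and \<open>\<sigma>2\<close> generate the group, it suffices that an
  isomorphism commutes with these two.\<close>

definition iso_to_matrix_module ::
  "('a::field \<Rightarrow> 'v::ab_group_add \<Rightarrow> 'v) \<Rightarrow> ('g \<Rightarrow> 'v \<Rightarrow> 'v) \<Rightarrow> 'g \<Rightarrow> 'g \<Rightarrow> 'v set
     \<Rightarrow> 'a mat \<times> 'a mat \<Rightarrow> bool" where
  "iso_to_matrix_module scale \<rho> \<sigma>1 \<sigma>2 U M \<longleftrightarrow>
     (\<exists>\<phi>. bij_betw \<phi> U (carrier_vec (dim_col (fst M))) \<and>
          (\<forall>x\<in>U. \<forall>y\<in>U. \<phi> (x + y) = \<phi> x + \<phi> y) \<and>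
          (\<forall>c. \<forall>x\<in>U. \<phi> (scale c x) = c \<cdot>\<^sub>v \<phi> x) \<and>
          (\<forall>x\<in>U. \<phi> (\<rho> \<sigma>1 x) = fst M *\<^sub>v \<phi> x) \<and>
          (\<forall>x\<in>U. \<phi> (\<rho> \<sigma>2 x) = snd M *\<^sub>v \<phi> x))"

text \<open>In the basis \<open>e, h\<close>, the matrix of \<open>e \<mapsto> e, h \<mapsto> h + c e\<close>.\<close>

definition transvection :: "'a::field \<Rightarrow> 'a mat" where
  "transvection c = mat_of_rows_list 2 [[1, c], [0, 1]]"

definition V2 :: "'a::field \<Rightarrow> 'a mat \<times> 'a mat" where
  "V2 c = (transvection 1, transvection c)"

definition W2 :: "'a::field mat \<times> 'a mat" where
  "W2 = (transvection 0, transvection 1)"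

definition W_odd :: "nat \<Rightarrow> 'a::field mat \<times> 'a mat" where
  "W_odd m =
     (four_block_mat (1\<^sub>m (m + 1)) ((1\<^sub>m m) @\<^sub>r (0\<^sub>m 1 m)) (0\<^sub>m m (m + 1)) (1\<^sub>m m),
      four_block_mat (1\<^sub>m (m + 1)) ((0\<^sub>m 1 m) @\<^sub>r (1\<^sub>m m)) (0\<^sub>m m (m + 1)) (1\<^sub>m m))"

definition in_list ::
  "('a::field \<Rightarrow> 'v::ab_group_add \<Rightarrow> 'v) \<Rightarrow> ('g \<Rightarrow> 'v \<Rightarrow> 'v) \<Rightarrow> 'g \<Rightarrow> 'g \<Rightarrow> 'v set \<Rightarrow> bool" where
  "in_list scale \<rho> \<sigma>1 \<sigma>2 U \<longleftrightarrow>
     iso_to_matrix_module scale \<rho> \<sigma>1 \<sigma>2 U (V2 0) \<or>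
     iso_to_matrix_module scale \<rho> \<sigma>1 \<sigma>2 U (V2 1) \<or>
     iso_to_matrix_module scale \<rho> \<sigma>1 \<sigma>2 U W2 \<or>
     (\<exists>m\<ge>1. iso_to_matrix_module scale \<rho> \<sigma>1 \<sigma>2 U (W_odd m))"

end

theory Submission
  imports Defs
begin

text \<open>
  Put \<open>X = \<sigma>1 - 1\<close> and \<open>Y = \<sigma>2 - 1\<close>; in characteristic 2 these are commuting operators of square
  zero. The norm of a linear form that vanishes nowhere on the orbit of \<open>v\<close> shows \<open>\<epsilon>(v) \<le> 4\<close>.
  A summand from the list has an invariant linear form or an invariant quadratic form not vanishing at
  a given nonzero vector: \<open>y\<^sup>2 + y z\<close> for the two-dimensional ones, and for \<open>W\<^sub>2\<^sub>m\<^sub>+\<^sub>1\<close>, with coordinates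
  \<open>l\<^sub>0, \<dots>, l\<^sub>m, w\<^sub>0, \<dots>, w\<^sub>m\<^sub>-\<^sub>1\<close>, the forms \<open>l\<^sub>i\<^sup>2 + T(2 i) + T(2 i - 1)\<close> where \<open>T(s)\<close> is the sum of
  the products \<open>l\<^sub>j w\<^sub>k\<close> with \<open>j + k = s\<close>.

  Conversely, let \<open>U\<close> be a nontrivial indecomposable summand on which invariant quadratic forms
  separate every nonzero fixed vector from 0. An invariant quadratic form \<open>q\<close> with polar form \<open>b\<close>
  satisfies \<open>q (X w) = b w (X w)\<close>, which forces \<open>X Y = 0\<close> on \<open>U\<close>, so that \<open>U\<close> is a Kronecker
  module, and which also forces a vector \<open>w\<close> with \<open>X w\<close>, \<open>Y w\<close> dependent and not both zero to span
  together with its image a direct summand isomorphic to \<open>V\<^sub>2\<^sub>,\<^sub>0\<close>, \<open>V\<^sub>2\<^sub>,\<^sub>1\<close> or \<open>W\<^sub>2\<close>. If there is no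
  such \<open>w\<close>, choose a linear form \<open>l\<close> that vanishes on \<open>X U\<close> but not on \<open>Y U\<close>, and let \<open>m\<close> be least
  such that \<open>l\<close> vanishes on \<open>N\<^sub>m\<close>, where \<open>N\<^sub>0 = Y U\<close> and \<open>N\<^sub>i\<^sub>+\<^sub>1 = Y (X\<^sup>-\<^sup>1 N\<^sub>i)\<close>. Then \<open>l\<close> extends
  to a chain of linear forms \<open>l = L\<^sub>m, \<dots>, L\<^sub>0\<close> with \<open>L\<^sub>j X = L\<^sub>j\<^sub>+\<^sub>1 Y\<close>, there is a chain of vectors
  \<open>w\<^sub>0, \<dots>, w\<^sub>m\<^sub>-\<^sub>1\<close> with \<open>Y w\<^sub>i = X w\<^sub>i\<^sub>+\<^sub>1\<close> and \<open>l (Y w\<^sub>m\<^sub>-\<^sub>1) = 1\<close>, and the two are dual to each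
  other, which splits off a copy of \<open>W\<^sub>2\<^sub>m\<^sub>+\<^sub>1\<close>.
\<close>

section \<open>Two commuting involutions in characteristic 2\<close>

locale klein_rep = vector_space scale
  for scale :: "'a::alg_closed_field \<Rightarrow> 'v::ab_group_add \<Rightarrow> 'v" +
  fixes \<rho> :: "'g \<Rightarrow> 'v \<Rightarrow> 'v" and \<sigma>1 \<sigma>2 :: 'g
  assumes two_eq_0: "(2::'a) = 0"
    and linear_1: "Vector_Spaces.linear scale scale (\<rho> \<sigma>1)"
    and linear_2: "Vector_Spaces.linear scale scale (\<rho> \<sigma>2)"
    and invol_1 [simp]: "\<rho> \<sigma>1 (\<rho> \<sigma>1 x) = x"
    and invol_2 [simp]: "\<rho> \<sigma>2 (\<rho> \<sigma>2 x) = x"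
    and commute: "\<rho> \<sigma>1 (\<rho> \<sigma>2 x) = \<rho> \<sigma>2 (\<rho> \<sigma>1 x)"
    and finite_dim: "\<exists>B. finite B \<and> span B = UNIV"
begin

abbreviation s1 where "s1 \<equiv> \<rho> \<sigma>1"
abbreviation s2 where "s2 \<equiv> \<rho> \<sigma>2"
definition X where "X x = s1 x + x"
definition Y where "Y x = s2 x + x"
abbreviation functional where "functional \<equiv> Vector_Spaces.linear scale ((*) :: 'a \<Rightarrow> 'a \<Rightarrow> 'a)"

lemma vector_space_scalars: "vector_space ((*) :: 'a \<Rightarrow> 'a \<Rightarrow> 'a)"
  unfolding vector_space_def by (simp add: distrib_left distrib_right mult.assoc)

lemma functional_iff:
  "functional f \<longleftrightarrow> (\<forall>x y. f (x + y) = f x + f y) \<and> (\<forall>c x. f (scale c x) = c * f x)"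
  using vector_space_axioms vector_space_scalars unfolding Vector_Spaces.linear_iff by auto

lemma functional_add: "functional f \<Longrightarrow> f (x + y) = f x + f y"
  and functional_scale: "functional f \<Longrightarrow> f (scale c x) = c * f x"
  by (auto simp: functional_iff)

lemma functional_0: "functional f \<Longrightarrow> f 0 = 0"
  using functional_scale[of f 0 0] by simp

lemma functional_sum: "functional f \<Longrightarrow> f (sum g A) = (\<Sum>x\<in>A. f (g x))"
  by (induction A rule: infinite_finite_induct) (auto simp: functional_0 functional_add)

lemma s_add [simp]: "s1 (x + y) = s1 x + s1 y" "s2 (x + y) = s2 x + s2 y"
  and s_scale [simp]: "s1 (scale c x) = scale c (s1 x)" "s2 (scale c x) = scale c (s2 x)"
  using linear_1 linear_2 by (auto simp: Vector_Spaces.linear_iff)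

lemma s_0 [simp]: "s1 0 = 0" "s2 0 = 0"
  using s_scale[of 0 0] by auto

lemma double_a [simp]: "(a::'a) + a = 0"
  using two_eq_0 by (metis mult_2 mult_zero_left)

lemma double_v [simp]: "(x::'v) + x = 0"
  using scale_left_distrib[of 1 1 x] by simp

lemma double_a' [simp]: "(a::'a) + (a + b) = b"
  by (simp add: add.assoc[symmetric])

lemma double_v' [simp]: "(x::'v) + (x + y) = y"
  by (simp add: add.assoc[symmetric])

lemma minus_a [simp]: "- (a::'a) = a"
  by (simp add: neg_eq_iff_add_eq_0)

lemma minus_v [simp]: "- (x::'v) = x"
  by (simp add: neg_eq_iff_add_eq_0)

lemma diff_a [simp]: "(a::'a) - b = a + b"
  by (metis diff_conv_add_uminus minus_a)

lemma diff_v [simp]: "(x::'v) - y = x + y"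
  by (metis diff_conv_add_uminus minus_v)

lemma add_eq_0_a: "(a::'a) + b = 0 \<longleftrightarrow> a = b"
  by (metis add_eq_0_iff minus_a)

lemma add_eq_0_v: "(x::'v) + y = 0 \<longleftrightarrow> x = y"
  by (metis add_eq_0_iff minus_v)

lemma X_add [simp]: "X (x + y) = X x + X y" and Y_add [simp]: "Y (x + y) = Y x + Y y"
  and X_scale [simp]: "X (scale c x) = scale c (X x)" and Y_scale [simp]: "Y (scale c x) = scale c (Y x)"
  by (auto simp: X_def Y_def algebra_simps)

lemma X_0 [simp]: "X 0 = 0" and Y_0 [simp]: "Y 0 = 0"
  by (auto simp: X_def Y_def)

lemma X_sum: "X (sum g A) = (\<Sum>x\<in>A. X (g x))" and Y_sum: "Y (sum g A) = (\<Sum>x\<in>A. Y (g x))"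
  by (induction A rule: infinite_finite_induct) auto

lemma X_X [simp]: "X (X x) = 0" and Y_Y [simp]: "Y (Y x) = 0"
  by (auto simp: X_def Y_def add_ac)

lemma X_Y: "X (Y x) = Y (X x)"
  by (auto simp: X_def Y_def commute add_ac)

lemma s1_eq: "s1 x = x + X x" and s2_eq: "s2 x = x + Y x"
  by (auto simp: X_def Y_def add_ac)

lemma functional_X: "functional f \<Longrightarrow> functional (\<lambda>x. f (X x))"
  and functional_Y: "functional f \<Longrightarrow> functional (\<lambda>x. f (Y x))"
  and functional_s1: "functional f \<Longrightarrow> functional (\<lambda>x. f (s1 x))"
  and functional_s2: "functional f \<Longrightarrow> functional (\<lambda>x. f (s2 x))"
  by (auto simp: functional_iff)

text \<open>\<open>stable\<close> and \<open>indec\<close> express \<open>subrep\<close> and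
  \<open>indecomposable\<close> through the two generators alone; the equivalence is established
  inside \<open>theorem15\<close>.\<close>

definition stable where
  "stable U \<longleftrightarrow> subspace U \<and> s1 ` U \<subseteq> U \<and> s2 ` U \<subseteq> U"

definition indec where
  "indec U \<longleftrightarrow> stable U \<and> U \<noteq> {0} \<and>
     (\<forall>A B. stable A \<and> stable B \<and> {a + b |a b. a \<in> A \<and> b \<in> B} = U \<and> A \<inter> B = {0}
        \<longrightarrow> A = {0} \<or> B = {0})"

lemma stable_X: "stable U \<Longrightarrow> x \<in> U \<Longrightarrow> X x \<in> U"
  and stable_Y: "stable U \<Longrightarrow> x \<in> U \<Longrightarrow> Y x \<in> U"
  unfolding stable_def X_def Y_def by (auto intro!: subspace_add)

subsection \<open>Linear forms\<close>

text \<open>A linear relation that is single-valued at 0 is the graph of a linear form on a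
  subspace, which is read off on a basis and extended. Forms defined through a non-unique preimage
  arise in this way, with well-definedness reduced to the fibre over 0.\<close>

lemma functional_of_graph:
  assumes zero: "(0, 0) \<in> S"
    and add: "\<And>x a y b. (x, a) \<in> S \<Longrightarrow> (y, b) \<in> S \<Longrightarrow> (x + y, a + b) \<in> S"
    and scale: "\<And>c x a. (x, a) \<in> S \<Longrightarrow> (scale c x, c * a) \<in> S"
    and single: "\<And>a. (0, a) \<in> S \<Longrightarrow> a = 0"
  shows "\<exists>f. functional f \<and> (\<forall>(x, a)\<in>S. f x = a)"
proof -
  interpret scalars: vector_space_pair scale "(*) :: 'a \<Rightarrow> 'a \<Rightarrow> 'a"
    using vector_space_axioms vector_space_scalars by (rule vector_space_pair.intro)
  have uniq: "a = b" if "(x, a) \<in> S" "(x, b) \<in> S" for x a b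
    using single[of "a + b"] add[OF that] by (simp add: add_eq_0_a)
  define g where "g x = (SOME a. (x, a) \<in> S)" for x
  have g: "(x, g x) \<in> S" if "x \<in> fst ` S" for x
    using that unfolding g_def by (auto intro: someI)
  obtain B where B: "B \<subseteq> fst ` S" "independent B" "fst ` S \<subseteq> span B"
    using maximal_independent_subset[of "fst ` S"] by blast
  obtain h where h: "functional h" "\<forall>x\<in>B. h x = g x"
    using scalars.linear_independent_extend[OF B(2), of g] by blast
  have graph: "(x, h x) \<in> S" if "x \<in> span B" for x
    using that
  proof (induction rule: span_induct_alt)
    case base
    then show ?case using zero h by (simp add: functional_0)
  next
    case (step c x y)
    have "(x, h x) \<in> S" using g[of x] h(2) B(1) step(1) by (metis subsetD)
    then show ?case using add[OF scale[of x "h x" c] step(2)] h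
      by (simp add: functional_add functional_scale)
  qed
  have "h x = a" if "(x, a) \<in> S" for x a
  proof -
    have "x \<in> fst ` S" using that by (metis fst_conv imageI)
    then show ?thesis using graph[of x] uniq[OF that] B(3) by blast
  qed
  with h show ?thesis by blast
qed

lemma functional_separates:
  assumes "subspace S" "x \<notin> S"
  shows "\<exists>f. functional f \<and> f x = 1 \<and> (\<forall>y\<in>S. f y = 0)"
proof -
  \<comment> \<open>\<open>?S\<close> records the coordinate along \<open>x\<close> on the sum of
    \<open>S\<close> and the line through \<open>x\<close>; it is single-valued because
    \<open>x\<close> is outside \<open>S\<close>.\<close>
  let ?S = "{(scale c x + y, c) |c y. y \<in> S}"
  have "\<exists>f. functional f \<and> (\<forall>(x, a)\<in>?S. f x = a)"
  proof (rule functional_of_graph)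
    show "(0, 0) \<in> ?S" using subspace_0[OF assms(1)] by force
  next
    fix u a v b assume "(u, a) \<in> ?S" "(v, b) \<in> ?S"
    then obtain y z where "u = scale a x + y" "v = scale b x + z" "y \<in> S" "z \<in> S" by auto
    then show "(u + v, a + b) \<in> ?S"
      by (intro CollectI exI[of _ "a + b"] exI[of _ "y + z"])
         (auto simp: algebra_simps intro!: subspace_add assms)
  next
    fix c u a assume "(u, a) \<in> ?S"
    then obtain y where "u = scale a x + y" "y \<in> S" by auto
    then show "(scale c u, c * a) \<in> ?S"
      by (intro CollectI exI[of _ "c * a"] exI[of _ "scale c y"])
         (auto simp: algebra_simps intro!: subspace_scale assms)
  next
    fix a assume "(0, a) \<in> ?S"
    then obtain y where y: "scale a x + y = 0" "y \<in> S" by auto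
    then have "scale a x \<in> S" by (simp add: add_eq_0_v)
    then have "a \<noteq> 0 \<Longrightarrow> x \<in> S"
      using subspace_scale[OF assms(1), of "scale a x" "inverse a"] by simp
    with assms show "a = 0" by blast
  qed
  then obtain f where f: "functional f" "\<forall>(u, a)\<in>?S. f u = a" by (elim exE conjE)
  then have graph: "f (scale c x + y) = c" if "y \<in> S" for c y using that by auto
  have "f x = 1" using graph[of 0 1] subspace_0[OF assms(1)] by simp
  moreover have "f y = 0" if "y \<in> S" for y using graph[of y 0] that by simp
  ultimately show ?thesis using f(1) by blast
qed

lemma functional_nonzero:
  assumes "x \<noteq> 0"
  shows "\<exists>f. functional f \<and> f x = 1"
  using functional_separates[of "{0}" x] assms by auto

text \<open>Otherwise the product of all \<open>t - a\<close>, plus 1, is a nonconstant polynomial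
  that takes the value 1 everywhere.\<close>

lemma infinite_scalars: "infinite (UNIV :: 'a set)"
proof
  assume fin: "finite (UNIV :: 'a set)"
  define p :: "'a poly" where "p = (\<Prod>a\<in>UNIV. [:- a, 1:]) + 1"
  have "poly p x = 1" for x
    using fin by (auto simp: p_def poly_prod intro: exI[of _ x])
  moreover have "degree (\<Prod>a\<in>(UNIV :: 'a set). [:- a, 1:]) > 0"
    using fin finite_UNIV_card_ge_0 by (subst degree_prod_eq_sum_degree) (auto simp: card_gt_0_iff)
  then have "degree p > 0"
    unfolding p_def by (subst degree_add_eq_left) auto
  ultimately show False
    using alg_closed_imp_poly_has_root[of p] by auto
qed

lemma functional_avoids:
  assumes "finite S" "0 \<notin> S"
  shows "\<exists>f. functional f \<and> (\<forall>x\<in>S. f x \<noteq> 0)"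
  using assms
proof (induction S)
  case empty
  show ?case by (intro exI[of _ "\<lambda>_. 0"]) (auto simp: functional_iff)
next
  case (insert v S)
  then obtain f where f: "functional f" "\<forall>x\<in>S. f x \<noteq> 0" by auto
  obtain g where g: "functional g" "g v = 1" using functional_nonzero[of v] insert by auto
  \<comment> \<open>A point with \<open>g x\<close> nonzero excludes the single value
    \<open>t = f x / g x\<close>; where \<open>g x = 0\<close> the value \<open>f x\<close> is kept,
    and such an \<open>x\<close> is not \<open>v\<close>.\<close>
  obtain t where t: "t \<notin> (\<lambda>x. f x / g x) ` insert v S"
    using ex_new_if_finite[OF infinite_scalars] insert(1) by (metis finite_imageI finite_insert)
  have "f x + t * g x \<noteq> 0" if "x \<in> insert v S" for x
  proof (cases "g x = 0")
    case True
    then show ?thesis using f g that by auto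
  next
    case False
    then have "f x \<noteq> t * g x" using t that by (auto simp: image_iff)
    then show ?thesis by (simp add: add_eq_0_a)
  qed
  moreover have "functional (\<lambda>x. f x + t * g x)"
    using f g by (auto simp: functional_iff algebra_simps)
  ultimately show ?case by blast
qed

lemma dependence:
  assumes B: "finite B" "span B = UNIV" and m: "card B \<le> m"
  shows "\<exists>c. (\<exists>i\<le>m. c i \<noteq> 0) \<and> (\<Sum>i\<le>m. scale (c i) (u i)) = 0"
proof (cases "inj_on u {..m}")
  case True
  have "\<not> independent (u ` {..m})"
    using independent_span_bound[OF B(1), of "u ` {..m}"] B(2) m card_image[OF True] by auto
  then obtain c v where c: "v \<in> u ` {..m}" "c v \<noteq> 0" "(\<Sum>v\<in>u ` {..m}. scale (c v) v) = 0"
    by (auto simp: dependent_finite)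
  then show ?thesis
    by (intro exI[of _ "\<lambda>i. c (u i)"]) (auto simp: sum.reindex[OF True])
next
  case False
  then obtain i j where ij: "i \<le> m" "j \<le> m" "i \<noteq> j" "u i = u j"
    by (auto simp: inj_on_def)
  \<comment> \<open>In characteristic 2 two equal vectors already sum to zero, so coefficients 1 at
    \<open>i\<close> and \<open>j\<close> give a relation.\<close>
  have "(\<Sum>k\<le>m. scale (of_bool (k = i) + of_bool (k = j)) (u k))
    = (\<Sum>k\<le>m. if k = i then u k else 0) + (\<Sum>k\<le>m. if k = j then u k else 0)"
    unfolding sum.distrib[symmetric] by (intro sum.cong) (auto simp: algebra_simps)
  also have "\<dots> = 0" using ij by (simp add: sum.delta)
  finally show ?thesis using ij
    by (intro exI[of _ "\<lambda>k. of_bool (k = i) + of_bool (k = j)"]) auto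
qed

text \<open>The \<open>p j\<close> span a direct complement of the common kernel of the dual forms \<open>R i\<close>, so that
  indecomposability leaves only their span.\<close>

lemma split_iso:
  assumes U: "indec U" and n: "n > 0" and U0: "\<And>j. j < n \<Longrightarrow> p j \<in> U"
    and R: "\<And>i. i < n \<Longrightarrow> functional (R i)"
    and dual: "\<And>i j. i < n \<Longrightarrow> j < n \<Longrightarrow> R i (p j) = of_bool (i = j)"
    and s1p: "\<And>j. j < n \<Longrightarrow> s1 (p j) \<in> span (p ` {..<n})"
    and s2p: "\<And>j. j < n \<Longrightarrow> s2 (p j) \<in> span (p ` {..<n})"
    and M: "M1 \<in> carrier_mat n n" "M2 \<in> carrier_mat n n"
    and R1: "\<And>i x. i < n \<Longrightarrow> x \<in> U \<Longrightarrow> R i (s1 x) = (M1 *\<^sub>v vec n (\<lambda>j. R j x)) $ i"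
    and R2: "\<And>i x. i < n \<Longrightarrow> x \<in> U \<Longrightarrow> R i (s2 x) = (M2 *\<^sub>v vec n (\<lambda>j. R j x)) $ i"
  shows "iso_to_matrix_module scale \<rho> \<sigma>1 \<sigma>2 U (M1, M2)"
proof -
  define A where "A = span (p ` {..<n})"
  define B where "B = {u \<in> U. \<forall>i<n. R i u = 0}"
  \<comment> \<open>\<open>pr\<close> is the projection onto \<open>A\<close> along
    \<open>B\<close>; duality makes it the identity on \<open>A\<close>.\<close>
  define pr where "pr x = (\<Sum>i<n. scale (R i x) (p i))" for x
  have st: "stable U" using U by (simp add: indec_def)
  then have sub: "subspace U" by (simp add: stable_def)
  have AU: "A \<subseteq> U" unfolding A_def using U0 sub by (intro span_minimal) auto
  have prA: "pr x \<in> A" for x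
    unfolding pr_def A_def by (intro span_sum span_scale span_base) auto
  have Rpr: "R i (pr x) = R i x" if "i < n" for i x
  proof -
    have "R i (pr x) = (\<Sum>j<n. if j = i then R i x else 0)"
      unfolding pr_def functional_sum[OF R[OF that]]
      by (intro sum.cong) (auto simp: functional_scale[OF R[OF that]] dual that)
    then show ?thesis using that by simp
  qed
  have "pr x = x" if "x \<in> A" for x
    using that unfolding A_def
  proof (induction rule: span_induct_alt)
    case base
    show ?case by (auto simp: pr_def functional_0 R)
  next
    case (step c x y)
    then obtain j where j: "j < n" "x = p j" by auto
    have "pr x = (\<Sum>i<n. if i = j then p j else 0)"
      unfolding pr_def by (intro sum.cong) (auto simp: j dual)
    then have "pr x = x" using j by simp
    moreover have "pr (scale c x + y) = scale c (pr x) + pr y"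
      by (simp add: pr_def functional_add functional_scale R algebra_simps scale_sum_right sum.distrib)
    ultimately show ?case using step by simp
  qed
  then have prid: "pr x = x" if "x \<in> A" for x using that .
  have stA: "stable A"
  proof -
    have "s1 ` A = span (s1 ` p ` {..<n})" "s2 ` A = span (s2 ` p ` {..<n})"
      using linear_1 linear_2 unfolding A_def linear_iff_module_hom
      by (simp_all add: module_hom.span_image)
    moreover have "span (s1 ` p ` {..<n}) \<subseteq> A" "span (s2 ` p ` {..<n}) \<subseteq> A"
      unfolding A_def using s1p s2p by (intro span_minimal; auto)+
    ultimately show ?thesis by (auto simp: stable_def A_def)
  qed
  have stB: "stable B"
  proof -
    have "subspace B"
      unfolding B_def using sub
      by (intro subspaceI)
         (auto simp: functional_0 functional_add functional_scale R
           intro: subspace_add subspace_scale subspace_0)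
    \<comment> \<open>By \<open>R1\<close> and \<open>R2\<close> the values of the
      \<open>R i\<close> at \<open>s1 x\<close> and \<open>s2 x\<close> are matrix combinations of
      the \<open>R j x\<close>, so both generators preserve the common kernel.\<close>
    moreover have z: "(M1 *\<^sub>v vec n (\<lambda>j. R j x)) $ i = 0" "(M2 *\<^sub>v vec n (\<lambda>j. R j x)) $ i = 0"
      if "x \<in> B" "i < n" for x i
      using that M by (auto simp: B_def scalar_prod_def)
    ultimately show ?thesis using st z
      by (auto simp: stable_def B_def R1 R2)
  qed
  have "{a + b |a b. a \<in> A \<and> b \<in> B} = U"
  proof (intro equalityI subsetI)
    fix x assume "x \<in> {a + b |a b. a \<in> A \<and> b \<in> B}"
    then show "x \<in> U" using AU sub by (auto simp: B_def intro: subspace_add)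
  next
    fix x assume x: "x \<in> U"
    \<comment> \<open>In characteristic 2 this is the complementary component
      \<open>x - pr x\<close>.\<close>
    have "pr x + x \<in> B"
      using x prA AU sub by (auto simp: B_def functional_add R Rpr intro: subspace_add)
    moreover have "x = pr x + (pr x + x)" by simp
    ultimately show "x \<in> {a + b |a b. a \<in> A \<and> b \<in> B}" using prA by blast
  qed
  moreover have "A \<inter> B = {0}"
  proof -
    have "x = 0" if "x \<in> A" "x \<in> B" for x
      using prid[OF that(1)] that(2) by (simp add: pr_def B_def)
    moreover have "0 \<in> A" "0 \<in> B" using stA stB by (auto simp: stable_def subspace_0)
    ultimately show ?thesis by auto
  qed
  moreover have "A \<noteq> {0}"
  proof
    assume "A = {0}"
    moreover have "p 0 \<in> A" unfolding A_def using n by (intro span_base) auto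
    ultimately show False using dual[of 0 0] n R by (auto simp: functional_0)
  qed
  ultimately have "B = {0}" using U stA stB unfolding indec_def by blast
  have prU: "pr x = x" if "x \<in> U" for x
  proof -
    have "pr x + x \<in> B"
      using that prA AU sub by (auto simp: B_def functional_add R Rpr intro: subspace_add)
    with \<open>B = {0}\<close> show ?thesis by (simp add: add_eq_0_v)
  qed
  define \<phi> where "\<phi> x = vec n (\<lambda>i. R i x)" for x
  have "bij_betw \<phi> U (carrier_vec n)"
  proof (rule bij_betwI')
    fix x y assume xy: "x \<in> U" "y \<in> U"
    show "\<phi> x = \<phi> y \<longleftrightarrow> x = y"
    proof
      assume "\<phi> x = \<phi> y"
      then have "R i x = R i y" if "i < n" for i
        using that by (metis \<phi>_def index_vec)
      then have "pr x = pr y" by (simp add: pr_def)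
      then show "x = y" using prU xy by simp
    qed simp
  next
    fix v :: "'a vec" assume v: "v \<in> carrier_vec n"
    let ?x = "\<Sum>j<n. scale (v $ j) (p j)"
    have "R i ?x = v $ i" if "i < n" for i
    proof -
      have "R i ?x = (\<Sum>j<n. if j = i then v $ i else 0)"
        unfolding functional_sum[OF R[OF that]]
        by (intro sum.cong) (auto simp: functional_scale[OF R[OF that]] dual that)
      then show ?thesis using that by simp
    qed
    then have "v = \<phi> ?x" using v by (auto simp: \<phi>_def)
    moreover have "?x \<in> U" using U0 sub by (auto intro!: subspace_sum subspace_scale)
    ultimately show "\<exists>x\<in>U. v = \<phi> x" by blast
  qed (simp add: \<phi>_def)
  moreover have "\<phi> (x + y) = \<phi> x + \<phi> y" "\<phi> (scale c x) = c \<cdot>\<^sub>v \<phi> x" for x y c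
    by (auto simp: \<phi>_def functional_add functional_scale R)
  moreover have "\<phi> (s1 x) = M1 *\<^sub>v \<phi> x" "\<phi> (s2 x) = M2 *\<^sub>v \<phi> x" if "x \<in> U" for x
    using M R1 R2 that by (auto simp: \<phi>_def intro!: eq_vecI)
  ultimately show ?thesis
    unfolding iso_to_matrix_module_def using M by (intro exI[of _ \<phi>]) auto
qed

subsection \<open>Injective Kronecker pencils\<close>

text \<open>A relation \<open>\<Sum>i. p\<^sub>i u\<^sub>i = 0\<close> along a chain is read as a polynomial; dividing \<open>p\<close> by a linear factor
  \<open>t - \<mu>\<close> turns it into an eigenvector equation \<open>Y w = \<mu> X w\<close>, and injectivity lowers the degree.\<close>

lemma pencil_chain:
  assumes sub: "subspace U"
    and inj: "\<And>w \<mu>. w \<in> U \<Longrightarrow> Y w = scale \<mu> (X w) \<Longrightarrow> X w = 0"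
    and u: "\<And>i. i \<le> m \<Longrightarrow> u i \<in> U" "\<And>i. i < m \<Longrightarrow> Y (u i) = X (u (Suc i))"
    and p: "p \<noteq> 0" "degree p \<le> m" "X (\<Sum>i\<le>m. scale (coeff p i) (u i)) = 0"
  shows "X (u 0) = 0"
  using p
proof (induction "degree p" arbitrary: p)
  case 0
  then obtain c where c: "p = [:c:]" "c \<noteq> 0" by (metis degree_eq_zeroE pCons_0_0)
  have "(\<Sum>i\<le>m. scale (coeff p i) (u i)) = (\<Sum>i\<le>m. if i = 0 then scale c (u 0) else 0)"
    by (intro sum.cong) (auto simp: c coeff_pCons split: nat.splits)
  then show ?case using 0 c by (simp add: sum.delta)
next
  case (Suc d)
  obtain \<mu> where "poly p \<mu> = 0"
    using alg_closed_imp_poly_has_root[of p] Suc(2) by auto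
  then obtain q where q: "p = [:\<mu>, 1:] * q" by (auto simp: poly_eq_0_iff_dvd elim!: dvdE)
  have "q \<noteq> 0" using q Suc by auto
  have "degree q = d" using Suc(2) q degree_mult_eq[of "[:\<mu>, 1:]" q] \<open>q \<noteq> 0\<close> by auto
  define w where "w = (\<Sum>i\<le>m. scale (coeff q i) (u i))"
  obtain n where n: "m = Suc n" using Suc by (cases m) auto
  \<comment> \<open>The degree of \<open>q\<close> is below \<open>m\<close>, so the sums over
    \<open>q\<close> stop at \<open>n\<close>, where \<open>Y (u i) = X (u (Suc i))\<close> is still
    available.\<close>
  have qm: "coeff q m = 0" using \<open>degree q = d\<close> Suc by (intro coeff_eq_0) auto
  \<comment> \<open>Multiplying \<open>q\<close> by \<open>t\<close> moves its coefficients one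
    place along the chain, and the chain relation turns that shift into \<open>Y\<close> in place of
    \<open>X\<close>.\<close>
  have "X (\<Sum>i\<le>m. scale (coeff p i) (u i))
      = (\<Sum>i\<le>m. scale \<mu> (scale (coeff q i) (X (u i))))
        + (\<Sum>i\<le>m. scale (case i of 0 \<Rightarrow> 0 | Suc j \<Rightarrow> coeff q j) (X (u i)))"
    unfolding X_sum sum.distrib[symmetric]
    by (intro sum.cong) (auto simp: q coeff_pCons algebra_simps split: nat.splits)
  also have "(\<Sum>i\<le>m. scale (case i of 0 \<Rightarrow> 0 | Suc j \<Rightarrow> coeff q j) (X (u i)))
      = (\<Sum>i\<le>n. scale (coeff q i) (X (u (Suc i))))"
    unfolding n sum.atMost_Suc_shift by simp
  also have "\<dots> = (\<Sum>i\<le>n. scale (coeff q i) (Y (u i)))"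
    using u(2) n by (intro sum.cong) auto
  also have "\<dots> = Y w"
    using qm by (simp add: w_def n Y_sum)
  also have "(\<Sum>i\<le>m. scale \<mu> (scale (coeff q i) (X (u i)))) = scale \<mu> (X w)"
    by (simp add: w_def X_sum scale_sum_right)
  finally have "Y w = scale \<mu> (X w)" using Suc.prems(3) by (simp add: add_eq_0_v)
  moreover have "w \<in> U" unfolding w_def using u(1) sub by (intro subspace_sum subspace_scale) auto
  ultimately have "X w = 0" by (intro inj)
  then show ?case using Suc.hyps(1)[of q] \<open>q \<noteq> 0\<close> \<open>degree q = d\<close> Suc.hyps(2) Suc.prems
    by (simp add: w_def)
qed

text \<open>The subspaces \<open>N\<^sub>i = Y (X\<^sup>-\<^sup>1 N\<^sub>i\<^sub>-\<^sub>1)\<close> of the introduction.\<close>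

primrec img :: "'v set \<Rightarrow> nat \<Rightarrow> 'v set" where
  "img U 0 = Y ` U"
| "img U (Suc i) = {Y u |u. u \<in> U \<and> X u \<in> img U i}"

lemma subspace_img: "subspace U \<Longrightarrow> subspace (img U i)"
proof (induction i)
  case 0
  show ?case
  proof (rule subspaceI)
    show "0 \<in> img U 0" using subspace_0[OF 0] by (force intro: image_eqI[of _ _ 0])
    show "x + y \<in> img U 0" if "x \<in> img U 0" "y \<in> img U 0" for x y
      using that subspace_add[OF 0] by (auto simp flip: Y_add)
    show "scale c x \<in> img U 0" if "x \<in> img U 0" for c x
      using that subspace_scale[OF 0] by (auto simp flip: Y_scale)
  qed
next
  case (Suc i)
  note I = Suc.IH[OF Suc.prems]
  show ?case
  proof (rule subspaceI)
    show "0 \<in> img U (Suc i)" using subspace_0[OF Suc.prems] subspace_0[OF I]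
      by (force intro: exI[of _ 0])
    show "x + y \<in> img U (Suc i)" if xy: "x \<in> img U (Suc i)" "y \<in> img U (Suc i)" for x y
    proof -
      obtain a b where "x = Y a" "y = Y b" "a \<in> U" "b \<in> U" "X a \<in> img U i" "X b \<in> img U i"
        using xy by auto
      then show ?thesis using subspace_add[OF Suc.prems] subspace_add[OF I]
        by (auto intro!: exI[of _ "a + b"])
    qed
    show "scale c x \<in> img U (Suc i)" if x: "x \<in> img U (Suc i)" for c x
    proof -
      obtain a where "x = Y a" "a \<in> U" "X a \<in> img U i" using x by auto
      then show ?thesis using subspace_scale[OF Suc.prems] subspace_scale[OF I]
        by (auto intro!: exI[of _ "scale c a"])
    qed
  qed
qed

lemma img_chain:
  assumes "y \<in> img U m"
  shows "\<exists>u. (\<forall>i\<le>m. u i \<in> U) \<and> (\<forall>i<m. Y (u i) = X (u (Suc i))) \<and> y = Y (u m)"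
  using assms
proof (induction m arbitrary: y)
  case 0
  then obtain v where "v \<in> U" "y = Y v" by auto
  then show ?case by (intro exI[of _ "\<lambda>_. v"]) auto
next
  case (Suc m)
  then obtain v where v: "v \<in> U" "y = Y v" "X v \<in> img U m" by auto
  obtain u where u: "\<forall>i\<le>m. u i \<in> U" "\<forall>i<m. Y (u i) = X (u (Suc i))" "X v = Y (u m)"
    using Suc.IH[OF v(3)] by blast
  then show ?case using v
    by (intro exI[of _ "u(Suc m := v)"]) (auto simp: le_Suc_eq less_Suc_eq)
qed

text \<open>The \<open>card B + 1\<close> vectors of the chain exceed the dimension bound, so they
  satisfy a nontrivial relation; its coefficients form the polynomial for
  \<open>pencil_chain\<close>.\<close>

lemma pencil_injective_chain:
  assumes sub: "subspace U"
    and inj: "\<And>w \<mu>. w \<in> U \<Longrightarrow> Y w = scale \<mu> (X w) \<Longrightarrow> X w = 0"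
    and B: "finite B" "span B = UNIV"
    and u: "\<And>i. i \<le> card B \<Longrightarrow> u i \<in> U" "\<And>i. i < card B \<Longrightarrow> Y (u i) = X (u (Suc i))"
  shows "X (u 0) = 0"
proof -
  let ?m = "card B"
  obtain c where c: "\<exists>i\<le>?m. c i \<noteq> 0" "(\<Sum>i\<le>?m. scale (c i) (u i)) = 0"
    using dependence[OF B, of ?m u] by auto
  define p where "p = Poly (map c [0..<Suc ?m])"
  have cp: "coeff p i = (if i \<le> ?m then c i else 0)" for i
    unfolding p_def coeff_Poly_eq by (auto simp: nth_default_def simp del: upt_Suc)
  have "p \<noteq> 0" using c(1) cp by (metis coeff_0)
  moreover have "degree p \<le> ?m" by (intro degree_le) (auto simp: cp)
  moreover have "X (\<Sum>i\<le>?m. scale (coeff p i) (u i)) = 0" using c(2) by (simp add: cp)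
  ultimately show ?thesis
    by (intro pencil_chain[where m = ?m and u = u and p = p and U = U]) (use sub inj u in auto)
qed

text \<open>Take \<open>m = card B\<close>. A chain leading to \<open>y\<close> starts with
  \<open>X (u 0) = 0\<close>; \<open>inj_X\<close> gives \<open>Y (u 0) = 0\<close>, which is
  \<open>X (u 1)\<close>, and this propagates up to \<open>Y (u m) = y\<close>.\<close>

lemma img_vanishes:
  assumes sub: "subspace U"
    and inj: "\<And>w \<mu>. w \<in> U \<Longrightarrow> Y w = scale \<mu> (X w) \<Longrightarrow> X w = 0"
    and inj_X: "\<And>w. w \<in> U \<Longrightarrow> X w = 0 \<Longrightarrow> Y w = 0"
  shows "\<exists>m. img U m = {0}"
proof -
  obtain B where B: "finite B" "span B = UNIV" using finite_dim by blast
  have "y = 0" if y: "y \<in> img U (card B)" for y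
  proof -
    obtain u where u: "\<forall>i\<le>card B. u i \<in> U" "\<forall>i<card B. Y (u i) = X (u (Suc i))"
      "y = Y (u (card B))"
      using img_chain[OF y] by blast
    have "X (u 0) = 0"
      using u by (intro pencil_injective_chain[OF sub inj B]) auto
    have "X (u i) = 0" if "i \<le> card B" for i
      using that
    proof (induction i)
      case (Suc i)
      then have "Y (u i) = 0" using u by (intro inj_X) auto
      then show ?case using u Suc by simp
    qed (use \<open>X (u 0) = 0\<close> in simp)
    then show "y = 0" using u by (auto intro: inj_X)
  qed
  then show ?thesis using subspace_0[OF subspace_img[OF sub]] by (intro exI[of _ "card B"]) blast
qed

text \<open>Otherwise repeatedly choosing preimages of \<open>Y x\<close> under \<open>X\<close>
  inside \<open>U\<close> builds an arbitrarily long chain starting at \<open>u0\<close>, which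
  forces \<open>X u0 = 0\<close>.\<close>

lemma img_Y_not_subset:
  assumes sub: "subspace U"
    and inj: "\<And>w \<mu>. w \<in> U \<Longrightarrow> Y w = scale \<mu> (X w) \<Longrightarrow> X w = 0"
    and u0: "u0 \<in> U" "X u0 \<noteq> 0"
  shows "\<not> Y ` U \<subseteq> X ` U"
proof
  assume *: "Y ` U \<subseteq> X ` U"
  obtain B where B: "finite B" "span B = UNIV" using finite_dim by blast
  define g where "g x = (SOME z. z \<in> U \<and> Y x = X z)" for x
  have g: "g x \<in> U \<and> Y x = X (g x)" if "x \<in> U" for x
  proof -
    have "\<exists>z. z \<in> U \<and> Y x = X z" using * that by (auto simp: image_subset_iff image_iff)
    then show ?thesis unfolding g_def by (rule someI_ex)
  qed
  define u where "u i = (g ^^ i) u0" for i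
  have "u i \<in> U" for i by (induction i) (use g u0 in \<open>auto simp: u_def\<close>)
  then have "X (u 0) = 0"
    using g by (intro pencil_injective_chain[OF sub inj B]) (auto simp: u_def)
  then show False using u0 by (simp add: u_def)
qed

text \<open>The two demands on \<open>l'\<close> are compatible: if \<open>X u\<close> lies in
  \<open>img U i\<close>, then \<open>Y u\<close> lies in \<open>img U (Suc i)\<close>, where
  \<open>l\<close> vanishes.\<close>

lemma functional_lift:
  assumes sub: "subspace U" and l: "functional l" "\<And>y. y \<in> img U (Suc i) \<Longrightarrow> l y = 0"
  shows "\<exists>l'. functional l' \<and> (\<forall>u\<in>U. l' (X u) = l (Y u)) \<and> (\<forall>y\<in>img U i. l' y = 0)"
proof -
  let ?S = "{(X u + n, l (Y u)) |u n. u \<in> U \<and> n \<in> img U i}"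
  note I = subspace_img[OF sub, of i]
  have "\<exists>f. functional f \<and> (\<forall>(x, a)\<in>?S. f x = a)"
  proof (rule functional_of_graph)
    show "(0, 0) \<in> ?S" using subspace_0[OF sub] subspace_0[OF I] functional_0[OF l(1)]
      by (intro CollectI exI[of _ 0]) auto
  next
    fix x a y b assume "(x, a) \<in> ?S" "(y, b) \<in> ?S"
    then obtain u n v k where "x = X u + n" "a = l (Y u)" "y = X v + k" "b = l (Y v)"
      "u \<in> U" "n \<in> img U i" "v \<in> U" "k \<in> img U i" by auto
    then show "(x + y, a + b) \<in> ?S" using subspace_add[OF sub] subspace_add[OF I] l
      by (intro CollectI exI[of _ "u + v"] exI[of _ "n + k"]) (auto simp: functional_add add_ac)
  next
    fix c x a assume "(x, a) \<in> ?S"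
    then obtain u n where "x = X u + n" "a = l (Y u)" "u \<in> U" "n \<in> img U i" by auto
    then show "(scale c x, c * a) \<in> ?S" using subspace_scale[OF sub] subspace_scale[OF I] l
      by (intro CollectI exI[of _ "scale c u"] exI[of _ "scale c n"])
         (auto simp: functional_scale scale_right_distrib)
  next
    fix a assume "(0, a) \<in> ?S"
    then obtain u n where un: "X u + n = 0" "a = l (Y u)" "u \<in> U" "n \<in> img U i" by auto
    then have "X u \<in> img U i" by (simp add: add_eq_0_v)
    then show "a = 0" using un l(2) by auto
  qed
  then obtain f where f: "functional f" "\<forall>(x, a)\<in>?S. f x = a" by (elim exE conjE)
  have graph: "f (X u + n) = l (Y u)" if "u \<in> U" "n \<in> img U i" for u n
    using f(2) that by auto
  have "\<forall>u\<in>U. f (X u) = l (Y u)" using graph[of _ 0] subspace_0[OF I] by auto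
  moreover have "\<forall>y\<in>img U i. f y = 0"
    using graph[of 0] subspace_0[OF sub] functional_0[OF l(1)] by auto
  ultimately show ?thesis using f(1) by blast
qed

text \<open>Each use of \<open>functional_lift\<close> lowers the level of \<open>img\<close> by
  one; at level 0 this set is the image of \<open>Y\<close>, whence the condition on
  \<open>L 0\<close>.\<close>

lemma functional_chain:
  assumes sub: "subspace U" and "functional l" "\<And>y. y \<in> img U m \<Longrightarrow> l y = 0"
  shows "\<exists>L. L m = l \<and> (\<forall>j\<le>m. functional (L j)) \<and> (\<forall>u\<in>U. L 0 (Y u) = 0) \<and>
    (\<forall>j<m. \<forall>u\<in>U. L j (X u) = L (Suc j) (Y u))"
  using assms(2,3)
proof (induction m arbitrary: l)
  case 0
  then show ?case by (intro exI[of _ "\<lambda>_. l"]) auto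
next
  case (Suc m)
  obtain l' where l': "functional l'" "\<forall>u\<in>U. l' (X u) = l (Y u)" "\<forall>y\<in>img U m. l' y = 0"
    using functional_lift[OF sub Suc.prems] by blast
  obtain L where "L m = l'" "\<forall>j\<le>m. functional (L j)" "\<forall>u\<in>U. L 0 (Y u) = 0"
    "\<forall>j<m. \<forall>u\<in>U. L j (X u) = L (Suc j) (Y u)"
    using Suc.IH[OF l'(1)] l'(3) by blast
  then show ?case using l' Suc.prems
    by (intro exI[of _ "L(Suc m := l)"]) (auto simp: le_Suc_eq less_Suc_eq)
qed

section \<open>Splitting off the modules \<open>W_odd m\<close>\<close>

lemma W_odd_dims: "fst (W_odd m) \<in> carrier_mat (2 * m + 1) (2 * m + 1)"
    "snd (W_odd m) \<in> carrier_mat (2 * m + 1) (2 * m + 1)"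
  by (auto simp: W_odd_def append_rows_def)

lemma mult_mat_vec_nth:
  assumes "A \<in> carrier_mat n n" "v \<in> carrier_vec n" "i < n"
  shows "(A *\<^sub>v v) $ i = (\<Sum>j<n. A $$ (i, j) * v $ j)"
  using assms by (auto simp: scalar_prod_def atLeast0LessThan)

text \<open>Positions 0 to \<open>m\<close> hold coordinates \<open>l 0, ..., l m\<close> and
  positions \<open>m + 1\<close> to \<open>2 * m\<close> hold \<open>w 0, ..., w (m - 1)\<close>.
  The first generator adds \<open>w i\<close> to \<open>l i\<close>; the second adds
  \<open>w (i - 1)\<close>, which sits at position \<open>m + i\<close>.\<close>

lemma W_odd_mult:
  fixes v :: "'a vec"
  assumes v: "v \<in> carrier_vec (2 * m + 1)" and i: "i < 2 * m + 1"
  shows "(fst (W_odd m) *\<^sub>v v) $ i = v $ i + (if i < m then v $ (m + 1 + i) else 0)"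
    and "(snd (W_odd m) *\<^sub>v v) $ i = v $ i + (if 0 < i \<and> i \<le> m then v $ (m + i) else 0)"
proof -
  have "(fst (W_odd m) *\<^sub>v v) $ i = (\<Sum>j<2 * m + 1. fst (W_odd m) $$ (i, j) * v $ j)"
    by (rule mult_mat_vec_nth[OF W_odd_dims(1) v i])
  also have "\<dots> = (\<Sum>j<2 * m + 1. (if j = i then v $ i else 0)
      + (if j = m + 1 + i then if i < m then v $ (m + 1 + i) else 0 else 0))"
    using i by (intro sum.cong) (auto simp: W_odd_def append_rows_def)
  also have "\<dots> = v $ i + (if i < m then v $ (m + 1 + i) else 0)"
    using i unfolding sum.distrib by (auto simp: sum.delta)
  finally show "(fst (W_odd m) *\<^sub>v v) $ i = v $ i + (if i < m then v $ (m + 1 + i) else 0)" .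
  have "(snd (W_odd m) *\<^sub>v v) $ i = (\<Sum>j<2 * m + 1. snd (W_odd m) $$ (i, j) * v $ j)"
    by (rule mult_mat_vec_nth[OF W_odd_dims(2) v i])
  also have "\<dots> = (\<Sum>j<2 * m + 1. (if j = i then v $ i else 0)
      + (if j = m + i then if 0 < i \<and> i \<le> m then v $ (m + i) else 0 else 0))"
  proof (intro sum.cong)
    fix j assume "j \<in> {..<2 * m + 1}"
    then have j: "j < 2 * m + 1" by simp
    have *: "i - Suc 0 = j - Suc m \<longleftrightarrow> j = m + i" if "0 < i" "\<not> j < Suc m"
      using that by linarith
    consider "i = 0" | "0 < i" "i \<le> m" "j < Suc m" | "0 < i" "i \<le> m" "\<not> j < Suc m" | "i > m"
      by linarith
    then show "snd (W_odd m) $$ (i, j) * v $ j = (if j = i then v $ i else 0)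
      + (if j = m + i then if 0 < i \<and> i \<le> m then v $ (m + i) else 0 else 0)"
      using i j * by cases (simp_all add: W_odd_def append_rows_def, linarith+)
  qed simp
  also have "\<dots> = v $ i + (if 0 < i \<and> i \<le> m then v $ (m + i) else 0)"
    using i unfolding sum.distrib by (auto simp: sum.delta)
  finally show "(snd (W_odd m) *\<^sub>v v) $ i = v $ i + (if 0 < i \<and> i \<le> m then v $ (m + i) else 0)" .
qed

lemma subspace_map:
  assumes "subspace U" "\<And>x y. T (x + y) = T x + T y" "\<And>c x. T (scale c x) = scale c (T x)"
  shows "subspace (T ` U)"
proof (rule subspaceI)
  have "T 0 = 0" using assms(3)[of 0 0] by simp
  then show "0 \<in> T ` U" using subspace_0[OF assms(1)] by (metis imageI)
  show "x + y \<in> T ` U" if "x \<in> T ` U" "y \<in> T ` U" for x y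
    using that subspace_add[OF assms(1)] by (auto simp flip: assms(2))
  show "scale c x \<in> T ` U" if "x \<in> T ` U" for c x
    using that subspace_scale[OF assms(1)] by (auto simp flip: assms(3))
qed

lemma W_odd_summand:
  assumes U: "indec U" and XY: "\<And>u. u \<in> U \<Longrightarrow> X (Y u) = 0"
    and inj: "\<And>w \<mu>. w \<in> U \<Longrightarrow> Y w = scale \<mu> (X w) \<Longrightarrow> X w = 0"
    and inj_X: "\<And>w. w \<in> U \<Longrightarrow> X w = 0 \<Longrightarrow> Y w = 0"
    and u0: "u0 \<in> U" "X u0 \<noteq> 0"
  shows "\<exists>m\<ge>1. iso_to_matrix_module scale \<rho> \<sigma>1 \<sigma>2 U (W_odd m)"
proof -
  have st: "stable U" using U by (simp add: indec_def)
  then have sub: "subspace U" by (simp add: stable_def)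
  have "\<not> Y ` U \<subseteq> X ` U" by (rule img_Y_not_subset[OF sub _ u0], fact inj)
  then obtain b0 where b0: "b0 \<in> U" "Y b0 \<notin> X ` U" by auto
  obtain l where l: "functional l" "l (Y b0) = 1" "\<forall>y\<in>X ` U. l y = 0"
    using functional_separates[OF subspace_map[OF sub X_add X_scale] b0(2)] by blast
  define P where "P m \<longleftrightarrow> (\<forall>y\<in>img U m. l y = 0)" for m
  have "\<exists>m. img U m = {0}" by (rule img_vanishes[OF sub], fact inj, fact inj_X)
  then have "\<exists>m. P m" using functional_0[OF l(1)] unfolding P_def by (metis singletonD)
  then obtain m where m: "P m" "\<forall>k<m. \<not> P k" using exists_least_iff[of P] by auto
  \<comment> \<open>Level 0 contains \<open>Y b0\<close>, where \<open>l\<close> is 1.\<close>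
  have "m \<noteq> 0" using m(1) l(2) b0(1) by (auto simp: P_def intro!: gr0I)
  then obtain n where n: "m = Suc n" by (cases m) auto
  obtain y where y: "y \<in> img U n" "l y \<noteq> 0" using m(2) n by (auto simp: P_def)
  define y' where "y' = scale (inverse (l y)) y"
  have "y' \<in> img U n" unfolding y'_def using y(1) by (intro subspace_scale subspace_img sub)
  then obtain w where w: "\<forall>i\<le>n. w i \<in> U" "\<forall>i<n. Y (w i) = X (w (Suc i))" "y' = Y (w n)"
    using img_chain by blast
  have ly: "l (Y (w n)) = 1" using y w(3) l(1) by (simp add: y'_def functional_scale flip: w(3))
  obtain L where L: "L m = l" "\<forall>j\<le>m. functional (L j)" "\<forall>u\<in>U. L 0 (Y u) = 0"
    "\<forall>j<m. \<forall>u\<in>U. L j (X u) = L (Suc j) (Y u)"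
    using functional_chain[OF sub l(1), of m] m(1) by (auto simp: P_def)
  \<comment> \<open>The \<open>m\<close> chain vectors have only \<open>m + 1\<close> images to
    list, since each \<open>Y (w i)\<close> with \<open>i < n\<close> is also
    \<open>X (w (Suc i))\<close>. They will be dual to \<open>L 0, ..., L m\<close>.\<close>
  define b where "b j = (case j of 0 \<Rightarrow> X (w 0) | Suc i \<Rightarrow> Y (w i))" for j
  have bX: "b j = X (w j)" if "j \<le> n" for j
    using w(2) that by (auto simp: b_def split: nat.splits)
  have bY: "b (Suc j) = Y (w j)" for j by (simp add: b_def)
  have bU: "b j \<in> U" if "j \<le> m" for j
    using that n w(1) by (auto simp: b_def intro!: stable_X[OF st] stable_Y[OF st] split: nat.splits)
  have Xb: "X (b j) = 0" and Yb: "Y (b j) = 0" if "j \<le> m" for j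
    using that n w(1) XY by (auto simp: b_def X_Y[symmetric] split: nat.splits)
  have shift: "L (Suc i) (b (Suc j)) = L i (b j)" if "i < m" "j < m" for i j
    using L(4) that n w(1) by (auto simp: bY bX)
  have T_shift: "L (i + d) (b (j + d)) = L i (b j)" if "i + d \<le> m" "j + d \<le> m" for i j d
    using that by (induction d) (auto simp: shift)
  have T0: "L 0 (b j) = 0" if "0 < j" "j \<le> m" for j
    using that L(3) w(1) n by (cases j) (auto simp: bY)
  have Tm: "L m (b j) = of_bool (j = m)" if "j \<le> m" for j
    using that l(3) ly w(1) n L(1) by (cases "j = m") (auto simp: bY bX)
  \<comment> \<open>The matrix \<open>L i (b j)\<close> is constant along diagonals. Entries with
    \<open>i < j\<close> move to row 0, where \<open>L 0\<close> kills the image of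
    \<open>Y\<close>; the others move to row \<open>m\<close>, where \<open>l\<close> kills the
    image of \<open>X\<close> and is 1 at \<open>b m\<close>.\<close>
  have T: "L i (b j) = of_bool (i = j)" if "i \<le> m" "j \<le> m" for i j
  proof (cases "i < j")
    case True
    then show ?thesis using T_shift[of 0 i "j - i"] T0[of "j - i"] that by simp
  next
    case False
    then show ?thesis using T_shift[of i "m - i" j] Tm[of "j + (m - i)"] that by auto
  qed
  \<comment> \<open>Adding a combination of the \<open>b i\<close> makes all \<open>L i\<close>
    vanish without changing the images under \<open>X\<close> and \<open>Y\<close>.\<close>
  define w' where "w' j = w j + (\<Sum>i\<le>m. scale (L i (w j)) (b i))" for j
  have Xw': "X (w' j) = X (w j)" and Yw': "Y (w' j) = Y (w j)" for j
    by (simp_all add: w'_def X_sum Y_sum Xb Yb)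
  have Lw': "L i (w' j) = 0" if "i \<le> m" for i j
  proof -
    have "L i (\<Sum>k\<le>m. scale (L k (w j)) (b k)) = (\<Sum>k\<le>m. if k = i then L i (w j) else 0)"
      using that L(2) by (subst functional_sum) (auto simp: functional_scale T intro!: sum.cong)
    then show ?thesis using that L(2) by (simp add: w'_def functional_add)
  qed
  \<comment> \<open>Since \<open>X (w' j) = b j\<close> for \<open>j < m\<close>, composing
    \<open>L i\<close> with \<open>X\<close> gives the forms dual to the
    \<open>w' j\<close>.\<close>
  define R where "R k = (if k \<le> m then L k else (\<lambda>x. L (k - m - 1) (X x)))" for k
  define p where "p k = (if k \<le> m then b k else w' (k - m - 1))" for k
  let ?n = "2 * m + 1"
  have bp: "b j \<in> span (p ` {..<?n})" if "j \<le> m" for j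
    using that by (intro span_base image_eqI[of _ _ j]) (auto simp: p_def)
  have Xp: "X (p j) \<in> span (p ` {..<?n})" and Yp: "Y (p j) \<in> span (p ` {..<?n})" if "j < ?n" for j
  proof -
    have "j - m - 1 \<le> n" using that n by auto
    then show "X (p j) \<in> span (p ` {..<?n})" "Y (p j) \<in> span (p ` {..<?n})"
      using bp[of "j - m - 1"] bp[of "Suc (j - m - 1)"] n
      by (auto simp: p_def Xb Yb Xw' Yw' bX bY span_zero)
  qed
  have "iso_to_matrix_module scale \<rho> \<sigma>1 \<sigma>2 U (fst (W_odd m), snd (W_odd m))"
  proof (rule split_iso[OF U, where R = R and p = p and n = ?n])
    show "p j \<in> U" if "j < ?n" for j
    proof -
      have "(\<Sum>i\<le>m. scale (L i (w (j - m - 1))) (b i)) \<in> U"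
        using bU sub by (intro subspace_sum subspace_scale) auto
      then show ?thesis
        using that bU w(1) n sub by (auto simp: p_def w'_def intro: subspace_add)
    qed
    show "functional (R i)" if "i < ?n" for i
      using that L(2) functional_X[of "L (i - m - 1)"] by (auto simp: R_def)
    show "R i (p j) = of_bool (i = j)" if "i < ?n" "j < ?n" for i j
      using that n L(2) by (auto simp: R_def p_def T Lw' Xb Xw' functional_0 simp flip: bX)
    show "s1 (p j) \<in> span (p ` {..<?n})" if "j < ?n" for j
      using that Xp[OF that] by (auto simp: s1_eq intro: span_add span_base)
    show "s2 (p j) \<in> span (p ` {..<?n})" if "j < ?n" for j
      using that Yp[OF that] by (auto simp: s2_eq intro: span_add span_base)
    fix i x assume i: "i < ?n" and x: "x \<in> U"
    have v: "vec ?n (\<lambda>j. R j x) \<in> carrier_vec ?n" by simp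
    show "R i (s1 x) = (fst (W_odd m) *\<^sub>v vec ?n (\<lambda>j. R j x)) $ i"
      unfolding W_odd_mult[OF v i] using i x l L(1,2)
      by (cases "i = m") (auto simp: R_def s1_eq functional_add functional_0)
    have "L i (Y x) = (if 0 < i then L (i - 1) (X x) else 0)" if "i \<le> m"
      using L(3,4) x that by (cases i) auto
    then show "R i (s2 x) = (snd (W_odd m) *\<^sub>v vec ?n (\<lambda>j. R j x)) $ i"
      unfolding W_odd_mult[OF v i] using i x L(2) XY[OF x]
      by (auto simp: R_def s2_eq functional_add functional_0)
  qed (use W_odd_dims[of m] in auto)
  then show ?thesis using n by (intro exI[of _ m]) simp
qed

section \<open>Splitting off the two-dimensional modules\<close>

lemma transvection_dims [simp]: "transvection c \<in> carrier_mat 2 2"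
  by (auto simp: transvection_def mat_of_rows_list_def)

lemma transvection_mult:
  fixes v :: "'a vec"
  assumes "v \<in> carrier_vec 2"
  shows "(transvection c *\<^sub>v v) $ 0 = v $ 0 + c * v $ 1" "(transvection c *\<^sub>v v) $ 1 = v $ 1"
  using assms by (auto simp: transvection_def mat_of_rows_list_def scalar_prod_def numeral_2_eq_2)

text \<open>Correcting \<open>w\<close> by a multiple of \<open>e\<close> makes \<open>f\<close> and
  \<open>g\<close> the dual basis of \<open>e\<close> and the corrected vector, so
  \<open>split_iso\<close> applies. In the applications \<open>g\<close> is \<open>f\<close>
  composed with \<open>X\<close> or \<open>Y\<close>.\<close>

lemma transvection_summand:
  assumes U: "indec U" and wU: "w \<in> U" and eU: "e \<in> U"
    and w: "X w = scale a e" "Y w = scale c e" and e: "X e = 0" "Y e = 0"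
    and f: "functional f" "f e = 1" and g: "functional g" "g w = 1" "g e = 0"
    and fX: "\<And>u. u \<in> U \<Longrightarrow> f (X u) = a * g u" and fY: "\<And>u. u \<in> U \<Longrightarrow> f (Y u) = c * g u"
    and gX: "\<And>u. u \<in> U \<Longrightarrow> g (X u) = 0" and gY: "\<And>u. u \<in> U \<Longrightarrow> g (Y u) = 0"
  shows "iso_to_matrix_module scale \<rho> \<sigma>1 \<sigma>2 U (transvection a, transvection c)"
proof -
  have sub: "subspace U" using U by (simp add: indec_def stable_def)
  define w' where "w' = w + scale (f w) e"
  define p where "p k = (if k = 0 then e else w')" for k :: nat
  define R where "R k = (if k = 0 then f else g)" for k :: nat
  have in_span: "e \<in> span (p ` {..<2})" "w' \<in> span (p ` {..<2})"
    using image_eqI[of e p 0 "{..<2}"] image_eqI[of w' p 1 "{..<2}"]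
    by (auto simp: p_def intro!: span_base)
  have vals: "f w' = 0" "g w' = 1" "X w' = scale a e" "Y w' = scale c e"
    using f g e w by (auto simp: w'_def functional_add functional_scale)
  have "w' \<in> U" unfolding w'_def using wU eU sub by (intro subspace_add subspace_scale)
  show ?thesis
  proof (rule split_iso[OF U, where R = R and p = p and n = 2])
    show "p j \<in> U" for j using \<open>w' \<in> U\<close> eU by (simp add: p_def)
    show "functional (R i)" for i using f g by (simp add: R_def)
    show "R i (p j) = of_bool (i = j)" if "i < 2" "j < 2" for i j
      using that f g vals by (auto simp: R_def p_def)
    show "s1 (p j) \<in> span (p ` {..<2})" "s2 (p j) \<in> span (p ` {..<2})" for j
      using in_span vals e by (auto simp: p_def s1_eq s2_eq intro: span_add span_scale)
    fix i x assume i: "i < (2::nat)" and x: "x \<in> U"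
    have v: "vec 2 (\<lambda>j. R j x) \<in> carrier_vec 2" by simp
    from i have i: "i = 0 \<or> i = Suc 0" by linarith
    have R_eq: "R 0 = f" "R (Suc 0) = g" by (simp_all add: R_def)
    note mult = transvection_mult[OF v, unfolded One_nat_def]
    show "R i (s1 x) = (transvection a *\<^sub>v vec 2 (\<lambda>j. R j x)) $ i"
      using i fX[OF x] gX[OF x] f g by (elim disjE) (simp_all add: mult R_eq s1_eq functional_add)
    show "R i (s2 x) = (transvection c *\<^sub>v vec 2 (\<lambda>j. R j x)) $ i"
      using i fY[OF x] gY[OF x] f g by (elim disjE) (simp_all add: mult R_eq s2_eq functional_add)
  qed auto
qed

subsection \<open>Invariant quadratic forms\<close>

lemma polar_form:
  assumes "q \<in> homogeneous_poly scale 2"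
  shows "\<exists>b. (\<forall>x y. q (x + y) = q x + q y + b x y) \<and> (\<forall>x y z. b x (y + z) = b x y + b x z) \<and>
    (\<forall>c x y. b x (scale c y) = c * b x y) \<and> (\<forall>x y. b x y = b y x) \<and> (\<forall>x. b x x = 0) \<and>
    (\<forall>c x. q (scale c x) = c * c * q x)"
proof -
  obtain n :: nat and c and l :: "nat \<Rightarrow> nat \<Rightarrow> 'v \<Rightarrow> 'a" where l: "\<forall>k<n. \<forall>i<2. functional (l k i)"
    and q: "q = (\<lambda>v. \<Sum>k<n. c k * (\<Prod>i<2. l k i v))"
    using assms unfolding homogeneous_poly_def by blast
  have q: "q v = (\<Sum>k<n. c k * (l k 0 v * l k 1 v))" for v
    by (simp add: q numeral_2_eq_2)
  have l: "functional (l k 0)" "functional (l k (Suc 0))" if "k < n" for k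
    using l that by auto
  show ?thesis
    by (intro exI[of _ "\<lambda>x y. \<Sum>k<n. c k * (l k 0 x * l k 1 y + l k 0 y * l k 1 x)"] conjI allI)
       (auto simp: q l functional_add functional_scale algebra_simps sum_distrib_left
          simp flip: sum.distrib intro!: sum.cong)
qed

definition inv_form where
  "inv_form d f \<longleftrightarrow>
     f \<in> homogeneous_poly scale d \<and> (\<forall>x. f (s1 x) = f x) \<and> (\<forall>x. f (s2 x) = f x)"

abbreviation quad_inv where "quad_inv \<equiv> inv_form 2"

text \<open>For the polar form \<open>b\<close>, invariance under \<open>s\<close> and
  \<open>s w = w\<close> give \<open>b w (s x) = b w x\<close>, so \<open>b w e = 0\<close>, while
  \<open>q (w + e) = q w\<close> says \<open>q e = b w e\<close>.\<close>

lemma quad_vanishes: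
  assumes q: "q \<in> homogeneous_poly scale 2" and we: "q (w + e) = q w"
    and s: "\<And>x y. s (x + y) = s x + s y" "\<And>x. q (s x) = q x" and w: "s w = w"
    and e: "e = s x + x"
  shows "q e = 0"
proof -
  obtain b where b: "\<And>x y. q (x + y) = q x + q y + b x y" "\<And>x y z. b x (y + z) = b x y + b x z"
    using polar_form[OF q] by blast
  have "q (s (w + x)) = q w + q x + b w (s x)" using s w b(1) by metis
  moreover have "q (s (w + x)) = q w + q x + b w x" using s b(1) by metis
  ultimately have "b w (s x) = b w x" by simp
  then have "b w e = 0" by (simp add: e b(2))
  then show ?thesis using we b(1)[of w e] by simp
qed

text \<open>The two equalities read \<open>q e = b w e\<close> and \<open>c^2 q e = c b w e\<close>,
  so \<open>c^2 = c\<close>.\<close>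

lemma quad_eigenvalue:
  assumes q: "q \<in> homogeneous_poly scale 2" and e: "q (w + e) = q w" "q (w + scale c e) = q w"
    and "q e \<noteq> 0" "c \<noteq> 0"
  shows "c = 1"
proof -
  obtain b where b: "\<And>x y. q (x + y) = q x + q y + b x y" "\<And>c x y. b x (scale c y) = c * b x y"
    "\<And>c x. q (scale c x) = c * c * q x"
    using polar_form[OF q] by blast
  have "q e = b w e" using e(1) by (simp add: b(1) add_eq_0_a add.assoc)
  moreover have "c * c * q e = c * b w e"
    using e(2) by (simp add: b add_eq_0_a add.assoc)
  ultimately show ?thesis using assms(4,5) by simp
qed

text \<open>Since \<open>q (X w) = b (s1 w) w\<close> for the polar form \<open>b\<close>, expanding
  at \<open>w = Y v\<close> gives four values of \<open>b\<close>, which cancel in pairs because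
  \<open>b\<close> is invariant under both generators.\<close>

lemma quad_XY:
  assumes "quad_inv q"
  shows "q (X (Y v)) = 0"
proof -
  have q: "q \<in> homogeneous_poly scale 2" and inv: "\<And>x. q (s1 x) = q x" "\<And>x. q (s2 x) = q x"
    using assms by (auto simp: inv_form_def)
  obtain b where b: "\<And>x y. q (x + y) = q x + q y + b x y" "\<And>x y z. b x (y + z) = b x y + b x z"
    and sym: "\<And>x y. b x y = b y x"
    using polar_form[OF q] by blast
  have b_left: "b (x + y) z = b x z + b y z" for x y z using b(2) sym by metis
  have b1: "b (s1 x) (s1 y) = b x y" for x y
    using b(1)[of x y] b(1)[of "s1 x" "s1 y"] inv(1)[of "x + y"] inv(1) by simp
  have b2: "b (s2 x) (s2 y) = b x y" for x y
    using b(1)[of x y] b(1)[of "s2 x" "s2 y"] inv(2)[of "x + y"] inv(2) by simp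
  have "q (X w) = b (s1 w) w" for w
    using b(1)[of "s1 w" w] inv(1) by (simp add: X_def)
  then have "q (X (Y v)) = b (s1 (Y v)) (Y v)" .
  also have "\<dots> = b (s2 (s1 v)) (s2 v) + b (s1 v) (s2 v) + (b (s1 (s2 v)) v + b (s1 v) v)"
    by (simp add: Y_def b(2) b_left commute add_ac)
  also have "b (s2 (s1 v)) (s2 v) = b (s1 v) v" by (rule b2)
  also have "b (s1 v) (s2 v) = b (s1 (s2 v)) v"
    using b1[of v "s1 (s2 v)"] sym by simp
  finally show ?thesis by (simp add: add_ac)
qed

lemma in_list_if_quadratics_separate:
  assumes U: "indec U" and nontriv: "\<exists>u\<in>U. X u \<noteq> 0 \<or> Y u \<noteq> 0"
    and good: "\<And>v. v \<in> U \<Longrightarrow> v \<noteq> 0 \<Longrightarrow> X v = 0 \<Longrightarrow> Y v = 0 \<Longrightarrow> \<exists>q. quad_inv q \<and> q v \<noteq> 0"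
  shows "in_list scale \<rho> \<sigma>1 \<sigma>2 U"
proof -
  have st: "stable U" using U by (simp add: indec_def)
  then have sub: "subspace U" by (simp add: stable_def)
  have XY: "X (Y u) = 0" if "u \<in> U" for u
  proof (rule ccontr)
    assume "X (Y u) \<noteq> 0"
    moreover have "X (Y u) \<in> U" using stable_X[OF st] stable_Y[OF st] that by blast
    moreover have "Y (X (Y u)) = 0" by (simp flip: X_Y)
    ultimately obtain q where "quad_inv q" "q (X (Y u)) \<noteq> 0" using good by (metis X_X)
    then show False using quad_XY by blast
  qed
  have YX: "Y (X u) = 0" if "u \<in> U" for u using XY[OF that] by (simp add: X_Y)
  \<comment> \<open>If \<open>w\<close> is fixed by one of the three involutions \<open>s\<close>,
    then a nonzero \<open>X w\<close> or \<open>Y w\<close> lies outside the image of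
    \<open>s - 1\<close>. The three choices of \<open>s\<close> lead to the three two-dimensional
    modules.\<close>
  have not_im: "e \<notin> (\<lambda>x. s x + x) ` U"
    if w: "w \<in> U" and e: "e = X w \<or> e = Y w" "e \<noteq> 0"
      and s: "s = s1 \<or> s = s2 \<or> s = (\<lambda>x. s1 (s2 x))" "s w = w" for w e s
  proof
    assume "e \<in> (\<lambda>x. s x + x) ` U"
    then obtain x where x: "e = s x + x" by blast
    obtain q where q: "quad_inv q" "q e \<noteq> 0"
      using good[of e] e stable_X[OF st w] stable_Y[OF st w] XY[OF w] YX[OF w] by auto
    have "q (w + e) = q w" using q e(1) by (auto simp: inv_form_def s1_eq s2_eq)
    then have "q e = 0"
      using q s x by (intro quad_vanishes[of q w e s x]) (auto simp: inv_form_def)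
    then show False using q by simp
  qed
  show ?thesis
  proof (cases "\<exists>w\<in>U. X w \<noteq> 0 \<and> Y w = 0")
    case True
    then obtain w where w: "w \<in> U" "X w \<noteq> 0" "Y w = 0" by blast
    have "X w \<notin> (\<lambda>x. s2 x + x) ` U"
      by (rule not_im[OF w(1) _ w(2)]) (use w s2_eq[of w] in simp_all)
    then have "X w \<notin> Y ` U" by (simp add: Y_def[abs_def])
    from functional_separates[OF subspace_map[OF sub Y_add Y_scale] this]
    obtain f where f: "functional f" "f (X w) = 1" "\<forall>y\<in>Y ` U. f y = 0"
      by blast
    have "iso_to_matrix_module scale \<rho> \<sigma>1 \<sigma>2 U (transvection 1, transvection 0)"
      by (rule transvection_summand[OF U w(1), of "X w" _ _ f "\<lambda>x. f (X x)"])
         (use w f XY YX in \<open>auto simp: stable_X[OF st] functional_X functional_0\<close>)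
    then show ?thesis by (simp add: in_list_def V2_def)
  next
    case A: False
    show ?thesis
    proof (cases "\<exists>w\<in>U. X w = 0 \<and> Y w \<noteq> 0")
      case True
      then obtain w where w: "w \<in> U" "X w = 0" "Y w \<noteq> 0" by blast
      have "Y w \<notin> (\<lambda>x. s1 x + x) ` U"
        by (rule not_im[OF w(1) _ w(3)]) (use w s1_eq[of w] in simp_all)
      then have "Y w \<notin> X ` U" by (simp add: X_def[abs_def])
      from functional_separates[OF subspace_map[OF sub X_add X_scale] this]
      obtain f where f: "functional f" "f (Y w) = 1" "\<forall>y\<in>X ` U. f y = 0"
        by blast
      have "iso_to_matrix_module scale \<rho> \<sigma>1 \<sigma>2 U (transvection 0, transvection 1)"
        by (rule transvection_summand[OF U w(1), of "Y w" _ _ f "\<lambda>x. f (Y x)"])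
           (use w f XY YX in \<open>auto simp: stable_Y[OF st] functional_Y functional_0\<close>)
      then show ?thesis by (simp add: in_list_def W2_def)
    next
      case B: False
      show ?thesis
      proof (cases "\<exists>w\<in>U. \<exists>c. X w \<noteq> 0 \<and> Y w = scale c (X w)")
        case True
        then obtain w c where w: "w \<in> U" "X w \<noteq> 0" "Y w = scale c (X w)" by blast
        have "c \<noteq> 0" using A w by auto
        obtain q where q: "quad_inv q" "q (X w) \<noteq> 0"
          using good[of "X w"] w stable_X[OF st w(1)] YX[OF w(1)] by auto
        \<comment> \<open>The two arguments are \<open>s1 w\<close> and \<open>s2 w\<close>.\<close>
        have "q (w + X w) = q w" "q (w + scale c (X w)) = q w"
          using q unfolding w(3)[symmetric] by (auto simp: inv_form_def simp flip: s1_eq s2_eq)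
        then have "c = 1"
          using quad_eigenvalue[of q w "X w" c] q \<open>c \<noteq> 0\<close> by (auto simp: inv_form_def)
        then have w3: "Y w = X w" using w by simp
        \<comment> \<open>As \<open>X Y = 0\<close> on \<open>U\<close>, the operator
          \<open>s - 1\<close> for \<open>s = s1 s2\<close> is \<open>X + Y\<close>. It kills
          \<open>w\<close> here, and a form vanishing on its image agrees on \<open>X u\<close> and
          \<open>Y u\<close>.\<close>
        have Z: "s1 (s2 u) + u = X u + Y u" if "u \<in> U" for u
          using XY[OF that] by (simp add: s1_eq s2_eq add_ac)
        have "X w \<notin> (\<lambda>x. s1 (s2 x) + x) ` U"
          by (rule not_im[OF w(1) _ w(2)]) (use Z[OF w(1)] w3 in \<open>simp_all add: add_eq_0_v\<close>)
        then have notin: "X w \<notin> (\<lambda>u. X u + Y u) ` U" using Z by (auto simp: image_iff)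
        have "subspace ((\<lambda>u. X u + Y u) ` U)"
          by (rule subspace_map[OF sub]) (simp_all add: scale_right_distrib add_ac)
        from functional_separates[OF this notin]
        obtain f where f: "functional f" "f (X w) = 1" "\<forall>y\<in>(\<lambda>u. X u + Y u) ` U. f y = 0"
          by (elim exE conjE)
        have "f (Y u) = f (X u)" if "u \<in> U" for u
          using f that by (auto simp: functional_add add_eq_0_a)
        then have "iso_to_matrix_module scale \<rho> \<sigma>1 \<sigma>2 U (transvection 1, transvection 1)"
          by (intro transvection_summand[OF U w(1), of "X w" _ _ f "\<lambda>x. f (X x)"])
             (use w w3 f XY YX in \<open>auto simp: stable_X[OF st] functional_X functional_0\<close>)
        then show ?thesis by (simp add: in_list_def V2_def)
      next
        \<comment> \<open>The excluded cases say that no \<open>w\<close> in \<open>U\<close> has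
          \<open>X w\<close> and \<open>Y w\<close> dependent but not both zero; these are the
          injectivity hypotheses of \<open>W_odd_summand\<close>.\<close>
        case C: False
        obtain u0 where "u0 \<in> U" "X u0 \<noteq> 0" using nontriv B by blast
        then have "\<exists>m\<ge>1. iso_to_matrix_module scale \<rho> \<sigma>1 \<sigma>2 U (W_odd m)"
          by (intro W_odd_summand[OF U XY]) (use B C in auto)
        then show ?thesis by (simp add: in_list_def)
      qed
    qed
  qed
qed

end

subsection \<open>Invariants of degree at most four\<close>

lemma sum_lessThan_add:
  fixes f :: "nat \<Rightarrow> 'b::comm_monoid_add"
  shows "(\<Sum>k<n + m. f k) = (\<Sum>k<n. f k) + (\<Sum>k<m. f (n + k))"
  by (induction m) (auto simp: add_ac)

context klein_rep
begin

lemma homogeneous_poly_add: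
  assumes "f \<in> homogeneous_poly scale d" "g \<in> homogeneous_poly scale d"
  shows "(\<lambda>v. f v + g v) \<in> homogeneous_poly scale d"
proof -
  obtain n :: nat and c and l where f: "\<forall>k<n. \<forall>i<d. functional (l k i)"
    "f = (\<lambda>v. \<Sum>k<n. c k * (\<Prod>i<d. l k i v))"
    using assms(1) unfolding homogeneous_poly_def by blast
  obtain n' :: nat and c' and l' where g: "\<forall>k<n'. \<forall>i<d. functional (l' k i)"
    "g = (\<lambda>v. \<Sum>k<n'. c' k * (\<Prod>i<d. l' k i v))"
    using assms(2) unfolding homogeneous_poly_def by blast
  define c'' where "c'' k = (if k < n then c k else c' (k - n))" for k
  define l'' where "l'' k = (if k < n then l k else l' (k - n))" for k
  have "functional (l'' k i)" if "k < n + n'" "i < d" for k i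
    using that f(1) g(1) by (auto simp: l''_def)
  moreover have "f v + g v = (\<Sum>k<n + n'. c'' k * (\<Prod>i<d. l'' k i v))" for v
    by (simp add: f(2) g(2) c''_def l''_def sum_lessThan_add)
  ultimately show ?thesis
    unfolding homogeneous_poly_def by (intro CollectI exI[of _ "n + n'"] exI[of _ c''] exI[of _ l'']) auto
qed

lemma homogeneous_poly_prod:
  assumes "\<And>i. i < d \<Longrightarrow> functional (l i)"
  shows "(\<lambda>v. \<Prod>i<d. l i v) \<in> homogeneous_poly scale d"
  unfolding homogeneous_poly_def
  by (intro CollectI exI[of _ 1] exI[of _ "\<lambda>_. 1"] exI[of _ "\<lambda>_. l"]) (use assms in auto)

lemma homogeneous_poly_0: "(\<lambda>v. 0) \<in> homogeneous_poly scale d"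
  unfolding homogeneous_poly_def by (intro CollectI exI[of _ 0]) auto

lemma homogeneous_poly_sum:
  assumes "\<And>i. i \<in> I \<Longrightarrow> f i \<in> homogeneous_poly scale d"
  shows "(\<lambda>v. \<Sum>i\<in>I. f i v) \<in> homogeneous_poly scale d"
  using assms
  by (induction I rule: infinite_finite_induct) (auto intro: homogeneous_poly_0 homogeneous_poly_add)

lemma homogeneous_poly_2:
  assumes "functional f" "functional g"
  shows "(\<lambda>v. f v * g v) \<in> homogeneous_poly scale 2"
  using homogeneous_poly_prod[of 2 "\<lambda>i. if i = 0 then f else g"] assms by (simp add: numeral_2_eq_2)

lemma homogeneous_poly_1_iff: "f \<in> homogeneous_poly scale 1 \<longleftrightarrow> functional f"
proof
  assume "f \<in> homogeneous_poly scale 1"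
  then obtain n :: nat and c and l :: "nat \<Rightarrow> nat \<Rightarrow> 'v \<Rightarrow> 'a"
    where l: "\<forall>k<n. \<forall>i<1. functional (l k i)" and f: "f = (\<lambda>v. \<Sum>k<n. c k * (\<Prod>i<1. l k i v))"
    unfolding homogeneous_poly_def by blast
  from l have "functional (l k 0)" if "k < n" for k using that by auto
  then show "functional f"
    unfolding functional_iff[of f]
    by (auto simp: f functional_add functional_scale sum_distrib_left algebra_simps
        simp flip: sum.distrib intro!: sum.cong)
next
  assume "functional f"
  then show "f \<in> homogeneous_poly scale 1" using homogeneous_poly_prod[of 1 "\<lambda>_. f"] by simp
qed

lemma exists_inv_form_4:
  assumes "v \<noteq> 0"
  shows "\<exists>f. inv_form 4 f \<and> f v \<noteq> 0"
proof -
  have s0: "s1 x = 0 \<longleftrightarrow> x = 0" "s2 x = 0 \<longleftrightarrow> x = 0" for x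
    using invol_1[of x] invol_2[of x] by fastforce+
  obtain l where l: "functional l" "\<forall>x\<in>{v, s1 v, s2 v, s1 (s2 v)}. l x \<noteq> 0"
  proof -
    have "finite {v, s1 v, s2 v, s1 (s2 v)}" by simp
    moreover have "0 \<notin> {v, s1 v, s2 v, s1 (s2 v)}" using assms s0 by (metis empty_iff insertE)
    ultimately show ?thesis using that by (elim exE conjE functional_avoids[elim_format])
  qed
  define f where "f v = l v * l (s1 v) * l (s2 v) * l (s1 (s2 v))" for v
  define L where "L i = [l, \<lambda>v. l (s1 v), \<lambda>v. l (s2 v), \<lambda>v. l (s1 (s2 v))] ! i" for i
  have "functional (L i)" if "i < 4" for i
  proof -
    have "i = 0 \<or> i = 1 \<or> i = 2 \<or> i = 3" using that by linarith
    then show ?thesis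
      using l functional_s1[OF l(1)] functional_s2[OF l(1)] functional_s2[OF functional_s1[OF l(1)]]
      by (elim disjE) (simp_all add: L_def)
  qed
  moreover have "f = (\<lambda>v. \<Prod>i<4. L i v)"
    by (rule ext) (simp add: f_def L_def eval_nat_numeral mult_ac)
  ultimately have "f \<in> homogeneous_poly scale 4" using homogeneous_poly_prod[of 4 L] by simp
  moreover have "f (s1 x) = f x" "f (s2 x) = f x" for x
    by (simp_all add: f_def commute mult_ac)
  moreover have "f v \<noteq> 0" using l(2) by (simp add: f_def)
  ultimately show ?thesis by (auto simp: inv_form_def)
qed

lemma poly_eq_if_pointwise_eq:
  fixes p q :: "'a poly"
  assumes "\<And>t. poly p t = poly q t"
  shows "p = q"
proof (rule ccontr)
  assume "p \<noteq> q"
  then have "finite {t. poly (p - q) t = 0}" by (intro poly_roots_finite) simp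
  with assms show False using infinite_scalars by simp
qed

text \<open>The linear part of an invariant cubic at a fixed point \<open>v\<close> is an invariant linear form, and
  Euler's identity gives its value \<open>3 f(v) = f(v)\<close> at \<open>v\<close>.\<close>

lemma inv_form_1_if_3:
  assumes f: "inv_form 3 f" "f v \<noteq> 0" and v: "s1 v = v" "s2 v = v"
  shows "\<exists>g. inv_form 1 g \<and> g v \<noteq> 0"
proof -
  have "f \<in> homogeneous_poly scale 3" using f by (simp add: inv_form_def)
  then obtain n :: nat and c and l :: "nat \<Rightarrow> nat \<Rightarrow> 'v \<Rightarrow> 'a"
    where l: "\<forall>k<n. \<forall>i<3. functional (l k i)" and fl: "f = (\<lambda>v. \<Sum>k<n. c k * (\<Prod>i<3. l k i v))"
    unfolding homogeneous_poly_def by blast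
  have l: "functional (l k i)" if "k < n" "i < 3" for k i using l that by blast
  \<comment> \<open>\<open>P w\<close> is the polynomial in \<open>t\<close> with values
    \<open>f (v + t w)\<close>. Over an infinite field these values determine it, so invariance of
    \<open>f\<close> passes to its coefficients.\<close>
  define P where "P w = (\<Sum>k<n. [:c k:] * (\<Prod>i<3. [:l k i v, l k i w:]))" for w
  have P: "poly (P w) t = f (v + scale t w)" for w t
    by (simp add: P_def fl poly_sum poly_prod functional_add functional_scale l)
  define g where "g w = coeff (P w) 1" for w
  have g: "g w = (\<Sum>k<n. c k * (l k 0 v * l k 1 v * l k 2 w + l k 0 v * l k 1 w * l k 2 v
      + l k 0 w * l k 1 v * l k 2 v))" for w
    unfolding g_def P_def coeff_sum
    by (intro sum.cong) (simp_all add: eval_nat_numeral coeff_pCons algebra_simps)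
  have "functional g"
    unfolding functional_iff[of g]
    by (auto simp: g functional_add functional_scale l sum_distrib_left
        algebra_simps simp flip: sum.distrib intro!: sum.cong)
  moreover have "P (s1 w) = P w" for w
  proof (rule poly_eq_if_pointwise_eq)
    fix t
    have "f (s1 (v + scale t w)) = f (v + scale t w)" using f(1) unfolding inv_form_def by blast
    then show "poly (P (s1 w)) t = poly (P w) t" by (simp add: P v)
  qed
  moreover have "P (s2 w) = P w" for w
  proof (rule poly_eq_if_pointwise_eq)
    fix t
    have "f (s2 (v + scale t w)) = f (v + scale t w)" using f(1) unfolding inv_form_def by blast
    then show "poly (P (s2 w)) t = poly (P w) t" by (simp add: P v)
  qed
  moreover have "g v = f v"
    by (simp add: g fl eval_nat_numeral mult_ac)
  ultimately show ?thesis
    using f(2) unfolding inv_form_def homogeneous_poly_1_iff by (intro exI[of _ g]) (simp add: g_def)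
qed

text \<open>Degrees 1 and 3 reduce to degree 2: an invariant linear form is squared, and an
  invariant cubic yields a linear one by \<open>inv_form_1_if_3\<close>.\<close>

lemma inv_form_le_3_vanishes:
  assumes v: "s1 v = v" "s2 v = v" and quad: "\<And>q. quad_inv q \<Longrightarrow> q v = 0"
    and d: "0 < d" "d < 4" and f: "inv_form d f"
  shows "f v = 0"
proof -
  have lin: "g v = 0" if "inv_form 1 g" for g
  proof -
    have "functional g" using that by (simp only: inv_form_def homogeneous_poly_1_iff)
    then have "quad_inv (\<lambda>v. g v * g v)"
      using that homogeneous_poly_2[of g g] by (simp add: inv_form_def)
    then show ?thesis using quad by force
  qed
  have "d = 1 \<or> d = 2 \<or> d = 3" using d by linarith
  then show ?thesis using f lin quad inv_form_1_if_3[of f v] v by blast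
qed

section \<open>Detecting vectors by invariants of degree one and two\<close>

lemma inv_form_1_vanishes: "inv_form 1 f \<Longrightarrow> f (X x) = 0" "inv_form 1 f \<Longrightarrow> f (Y x) = 0"
  unfolding inv_form_def homogeneous_poly_1_iff by (auto simp: X_def Y_def functional_add)

text \<open>The linear form \<open>z\<close> serves unless \<open>z x = 0\<close>. In that case
  \<open>y (y + z)\<close> serves: as \<open>a\<close> and \<open>c\<close> are 0 or 1, each
  generator fixes or swaps its two factors.\<close>

lemma inv_form_transvection:
  assumes lin: "functional y" "functional z"
    and y: "\<And>x. y (s1 x) = y x + a * z x" "\<And>x. y (s2 x) = y x + c * z x"
    and z: "\<And>x. z (s1 x) = z x" "\<And>x. z (s2 x) = z x"
    and ac: "a \<in> {0, 1}" "c \<in> {0, 1}" and nz: "y x \<noteq> 0 \<or> z x \<noteq> 0"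
  shows "\<exists>d\<in>{1,2}. \<exists>f. inv_form d f \<and> f x \<noteq> 0"
proof (cases "z x = 0")
  case False
  have "inv_form 1 z" unfolding inv_form_def homogeneous_poly_1_iff using lin z by simp
  then show ?thesis using False by blast
next
  case True
  have "(\<lambda>x. y x * y x + y x * z x) \<in> homogeneous_poly scale 2"
    using lin by (intro homogeneous_poly_add homogeneous_poly_2)
  then have "inv_form 2 (\<lambda>x. y x * y x + y x * z x)"
    using ac by (auto simp: inv_form_def y z algebra_simps)
  moreover have "y x * y x + y x * z x \<noteq> 0" using True nz by simp
  ultimately show ?thesis by blast
qed

text \<open>Exchanging the two arguments of \<open>h\<close> pairs equal terms, which cancel in
  characteristic 2; an odd total leaves no term unpaired. The induction strips the two outer
  terms.\<close>

lemma sum_symmetric_odd: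
  fixes h :: "nat \<Rightarrow> nat \<Rightarrow> 'a"
  assumes "\<And>a b. h a b = h b a"
  shows "(\<Sum>j\<le>Suc (2 * i). h j (Suc (2 * i) - j)) = 0"
  using assms
proof (induction i arbitrary: h)
  case 0
  then show ?case using 0[of 0 1] by simp
next
  case (Suc i)
  have "(\<Sum>j\<le>Suc (Suc (Suc (2 * i))). h j (Suc (Suc (Suc (2 * i))) - j))
    = (\<Sum>j\<le>Suc (2 * i). h (Suc j) (Suc (Suc (2 * i) - j)))"
    using Suc.prems[of 0 "Suc (Suc (Suc (2 * i)))"]
    unfolding sum.atMost_Suc[of _ "Suc (Suc (2 * i))"] sum.atMost_Suc_shift[of _ "Suc (2 * i)"]
    by (simp add: Suc_diff_le add_ac)
  also have "\<dots> = 0" using Suc.IH[of "\<lambda>a b. h (Suc a) (Suc b)"] Suc.prems by simp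
  finally show ?case by simp
qed

text \<open>The same pairing leaves only the middle term.\<close>

lemma sum_symmetric_even:
  fixes h :: "nat \<Rightarrow> nat \<Rightarrow> 'a"
  assumes "\<And>a b. h a b = h b a"
  shows "(\<Sum>j\<le>2 * i. h j (2 * i - j)) = h i i"
  using assms
proof (induction i arbitrary: h)
  case 0
  then show ?case by simp
next
  case (Suc i)
  have "(\<Sum>j\<le>Suc (Suc (2 * i)). h j (Suc (Suc (2 * i)) - j))
    = (\<Sum>j\<le>2 * i. h (Suc j) (Suc (2 * i - j)))"
    using Suc.prems[of 0 "Suc (Suc (2 * i))"]
    unfolding sum.atMost_Suc[of _ "Suc (2 * i)"] sum.atMost_Suc_shift[of _ "2 * i"]
    by (simp add: Suc_diff_le add_ac)
  also have "\<dots> = h (Suc i) (Suc i)" using Suc.IH[of "\<lambda>a b. h (Suc a) (Suc b)"] Suc.prems by simp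
  finally show ?case by simp
qed

text \<open>Indexing by all naturals treats every \<open>W_odd m\<close> at once: its finite
  families of coordinates are padded with zero forms in \<open>inv_form_in_list\<close>.\<close>

lemma inv_form_chain:
  fixes l w :: "nat \<Rightarrow> 'v \<Rightarrow> 'a"
  assumes lin: "\<And>i. functional (l i)" "\<And>i. functional (w i)"
    and w: "\<And>i x. w i (s1 x) = w i x" "\<And>i x. w i (s2 x) = w i x"
    and l1: "\<And>i x. l i (s1 x) = l i x + w i x"
    and l2: "\<And>x. l 0 (s2 x) = l 0 x" "\<And>i x. l (Suc i) (s2 x) = l (Suc i) x + w i x"
    and nz: "l i x \<noteq> 0 \<or> w i x \<noteq> 0"
  shows "\<exists>d\<in>{1,2}. \<exists>f. inv_form d f \<and> f x \<noteq> 0"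
proof (cases "\<exists>j. w j x \<noteq> 0")
  case True
  then obtain j where "w j x \<noteq> 0" by blast
  moreover have "inv_form 1 (w j)" unfolding inv_form_def homogeneous_poly_1_iff using lin w by simp
  ultimately show ?thesis by blast
next
  case False
  define T where "T s x = (\<Sum>j\<le>s. l j x * w (s - j) x)" for s x
  \<comment> \<open>\<open>C s\<close> is the change of \<open>T s\<close> under \<open>s1\<close>
    and of \<open>T (Suc s)\<close> under \<open>s2\<close>. By symmetry it is 0 for odd
    \<open>s\<close> and the square of \<open>w k\<close> for \<open>s = 2 * k\<close>.\<close>
  define C where "C s x = (\<Sum>j\<le>s. w j x * w (s - j) x)" for s x
  have T1: "T s (s1 x) = T s x + C s x" for s x
    by (simp add: T_def C_def l1 w distrib_right sum.distrib)
  have T2: "T 0 (s2 x) = T 0 x" "T (Suc s) (s2 x) = T (Suc s) x + C s x" for s x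
    unfolding T_def C_def sum.atMost_Suc_shift
    by (simp_all add: l2 w distrib_right sum.distrib add_ac del: sum.atMost_Suc)
  have C0: "C (Suc (2 * k)) x = 0" for k x
    unfolding C_def by (rule sum_symmetric_odd) (simp add: mult.commute)
  have C1: "C (2 * k) x = w k x * w k x" for k x
    unfolding C_def by (rule sum_symmetric_even) (simp add: mult.commute)
  have T_hom: "T s \<in> homogeneous_poly scale 2" for s
    unfolding T_def[abs_def] by (intro homogeneous_poly_sum homogeneous_poly_2 lin)
  \<comment> \<open>Under \<open>s1\<close> the first term changes by the square of
    \<open>w i\<close>, as does \<open>T (2 * i)\<close>. Under \<open>s2\<close>, for positive
    \<open>i\<close>, it changes by the square of \<open>w (i - 1)\<close>, as does
    \<open>T (2 * i - 1)\<close>. For \<open>i = 0\<close> natural subtraction would make the last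
    index 0, so that term is replaced by zero.\<close>
  define Q where "Q x = l i x * l i x + (T (2 * i) x + (if i = 0 then 0 else T (2 * i - 1) x))" for x
  have "(\<lambda>x. if i = 0 then 0 else T (2 * i - 1) x) \<in> homogeneous_poly scale 2"
    using T_hom homogeneous_poly_0 by (cases "i = 0") simp_all
  then have "Q \<in> homogeneous_poly scale 2"
    unfolding Q_def[abs_def] by (intro homogeneous_poly_add homogeneous_poly_2 lin T_hom)
  moreover have "Q (s1 x) = Q x" "Q (s2 x) = Q x" for x
  proof -
    show "Q (s1 x) = Q x"
    proof (cases i)
      case 0
      then show ?thesis using C1[of 0 x] by (simp add: Q_def T1 l1 algebra_simps)
    next
      case (Suc k)
      then show ?thesis using C0[of k x] C1[of "Suc k" x] by (simp add: Q_def T1 l1 algebra_simps)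
    qed
    show "Q (s2 x) = Q x"
    proof (cases i)
      case 0
      then show ?thesis by (simp add: Q_def T2 l2)
    next
      case (Suc k)
      then show ?thesis using C0[of k x] C1[of k x] by (simp add: Q_def T2 l2 algebra_simps)
    qed
  qed
  moreover have "Q x \<noteq> 0"
  proof -
    have "T s x = 0" for s using False by (simp add: T_def)
    then show ?thesis using nz False by (auto simp: Q_def)
  qed
  ultimately show ?thesis unfolding inv_form_def by blast
qed

text \<open>The matrix coordinates of \<open>pr x\<close> are forms on the whole space that
  transform by the given matrices, so invariants of a summand can be written as invariants of the
  whole space.\<close>

lemma iso_functionals:
  assumes iso: "iso_to_matrix_module scale \<rho> \<sigma>1 \<sigma>2 U (M1, M2)"
    and M: "M1 \<in> carrier_mat n n"
    and sub: "subspace U"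
    and pr: "\<And>x y. pr (x + y) = pr x + pr y" "\<And>c x. pr (scale c x) = scale c (pr x)"
      "\<And>x. pr x \<in> U" "\<And>x. pr (s1 x) = s1 (pr x)" "\<And>x. pr (s2 x) = s2 (pr x)"
  shows "\<exists>R. (\<forall>i<n. functional (R i)) \<and>
    (\<forall>i<n. \<forall>x. R i (s1 x) = (M1 *\<^sub>v vec n (\<lambda>j. R j x)) $ i) \<and>
    (\<forall>i<n. \<forall>x. R i (s2 x) = (M2 *\<^sub>v vec n (\<lambda>j. R j x)) $ i) \<and>
    (\<forall>x. pr x \<noteq> 0 \<longrightarrow> (\<exists>i<n. R i x \<noteq> 0))"
proof -
  obtain \<phi> where bij: "bij_betw \<phi> U (carrier_vec n)"
    and add: "\<forall>x\<in>U. \<forall>y\<in>U. \<phi> (x + y) = \<phi> x + \<phi> y"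
    and scl: "\<forall>c. \<forall>x\<in>U. \<phi> (scale c x) = c \<cdot>\<^sub>v \<phi> x"
    and M1: "\<forall>x\<in>U. \<phi> (s1 x) = M1 *\<^sub>v \<phi> x" and M2: "\<forall>x\<in>U. \<phi> (s2 x) = M2 *\<^sub>v \<phi> x"
    using iso M unfolding iso_to_matrix_module_def by auto
  have car: "\<phi> (pr x) \<in> carrier_vec n" for x by (rule bij_betw_apply[OF bij pr(3)])
  have dim: "dim_vec (\<phi> (pr x)) = n" for x by (rule carrier_vecD[OF car])
  define R where "R i x = \<phi> (pr x) $ i" for i x
  have vec: "vec n (\<lambda>j. R j x) = \<phi> (pr x)" for x using dim by (auto simp: R_def)
  have "functional (R i)" if "i < n" for i
    using that pr add scl dim by (simp add: functional_iff R_def)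
  moreover have "R i (s1 x) = (M1 *\<^sub>v vec n (\<lambda>j. R j x)) $ i"
    "R i (s2 x) = (M2 *\<^sub>v vec n (\<lambda>j. R j x)) $ i" for i x
    unfolding vec using M1 M2 pr by (simp_all add: R_def)
  moreover have "\<exists>i<n. R i x \<noteq> 0" if x: "pr x \<noteq> 0" for x
  proof (rule ccontr)
    assume "\<not> (\<exists>i<n. R i x \<noteq> 0)"
    then have zero: "\<phi> (pr x) = 0\<^sub>v n" using dim by (auto simp: R_def)
    have "\<phi> (scale 0 (pr 0)) = 0 \<cdot>\<^sub>v \<phi> (pr 0)" using scl pr(3)[of 0] by blast
    also have "\<dots> = 0\<^sub>v n" using dim[of 0] by auto
    finally have "\<phi> 0 = 0\<^sub>v n" by simp
    with zero have "\<phi> (pr x) = \<phi> 0" by simp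
    then have "pr x = 0"
      by (rule inj_onD[OF bij_betw_imp_inj_on[OF bij] _ pr(3) subspace_0[OF sub]])
    with x show False by simp
  qed
  ultimately show ?thesis by (intro exI[of _ R]) blast
qed

lemma inv_form_in_list:
  assumes U: "in_list scale \<rho> \<sigma>1 \<sigma>2 U" and sub: "subspace U"
    and pr: "\<And>x y. pr (x + y) = pr x + pr y" "\<And>c x. pr (scale c x) = scale c (pr x)"
      "\<And>x. pr x \<in> U" "\<And>x. pr (s1 x) = s1 (pr x)" "\<And>x. pr (s2 x) = s2 (pr x)"
    and x: "pr x \<noteq> 0"
  shows "\<exists>d\<in>{1,2}. \<exists>f. inv_form d f \<and> f x \<noteq> 0"
proof -
  have trans: ?thesis if iso: "iso_to_matrix_module scale \<rho> \<sigma>1 \<sigma>2 U (transvection a, transvection c)"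
    and ac: "a \<in> {0, 1}" "c \<in> {0, 1}" for a c
  proof -
    obtain R where R: "\<forall>i<2. functional (R i)"
      "\<forall>i<2. \<forall>x. R i (s1 x) = (transvection a *\<^sub>v vec 2 (\<lambda>j. R j x)) $ i"
      "\<forall>i<2. \<forall>x. R i (s2 x) = (transvection c *\<^sub>v vec 2 (\<lambda>j. R j x)) $ i"
      "\<forall>x. pr x \<noteq> 0 \<longrightarrow> (\<exists>i<2. R i x \<noteq> 0)"
      using iso_functionals[OF iso transvection_dims sub pr] by (elim exE conjE) (rule that)
    have v: "vec 2 (\<lambda>j. R j y) \<in> carrier_vec 2" for y by simp
    obtain i where "i < 2" "R i x \<noteq> 0" using R(4) x by blast
    then have "R 0 x \<noteq> 0 \<or> R 1 x \<noteq> 0" by (metis One_nat_def less_2_cases)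
    then show ?thesis
      by (intro inv_form_transvection[of "R 0" "R 1" a c])
         (use R(1) ac in \<open>simp_all add: R(2,3) transvection_mult[OF v] transvection_mult[OF v, unfolded One_nat_def]\<close>)
  qed
  have odd: ?thesis if iso: "iso_to_matrix_module scale \<rho> \<sigma>1 \<sigma>2 U (W_odd m)" for m
  proof -
    let ?n = "2 * m + 1"
    have "iso_to_matrix_module scale \<rho> \<sigma>1 \<sigma>2 U (fst (W_odd m), snd (W_odd m))" using iso by simp
    from iso_functionals[OF this W_odd_dims(1) sub pr]
    obtain R where R: "\<forall>i<?n. functional (R i)"
      "\<forall>i<?n. \<forall>x. R i (s1 x) = (fst (W_odd m) *\<^sub>v vec ?n (\<lambda>j. R j x)) $ i"
      "\<forall>i<?n. \<forall>x. R i (s2 x) = (snd (W_odd m) *\<^sub>v vec ?n (\<lambda>j. R j x)) $ i"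
      "\<forall>x. pr x \<noteq> 0 \<longrightarrow> (\<exists>i<?n. R i x \<noteq> 0)"
      by (elim exE conjE) (rule that)
    have v: "vec ?n (\<lambda>j. R j y) \<in> carrier_vec ?n" for y by simp
    have R1: "R i (s1 y) = R i y + (if i < m then R (m + 1 + i) y else 0)" if "i < ?n" for i y
      using R(2) that W_odd_mult(1)[OF v that, of y] by auto
    have R2: "R i (s2 y) = R i y + (if 0 < i \<and> i \<le> m then R (m + i) y else 0)" if "i < ?n" for i y
      using R(3) that W_odd_mult(2)[OF v that, of y] by auto
    define l where "l i = (if i \<le> m then R i else (\<lambda>_. 0))" for i
    define w where "w i = (if i < m then R (m + 1 + i) else (\<lambda>_. 0))" for i
    obtain i where i: "i < ?n" "R i x \<noteq> 0" using R(4) x by blast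
    then have "l (if i \<le> m then i else i - (m + 1)) x \<noteq> 0 \<or>
        w (if i \<le> m then i else i - (m + 1)) x \<noteq> 0"
      by (auto simp: l_def w_def)
    moreover have z: "functional (\<lambda>_. 0)" by (auto simp: functional_iff)
    moreover have "l i (s1 y) = l i y + w i y" "w i (s1 y) = w i y" "w i (s2 y) = w i y"
      "l (Suc i) (s2 y) = l (Suc i) y + w i y" "l 0 (s2 y) = l 0 y" for i y
      by (auto simp: l_def w_def R1 R2)
    moreover have "functional (l i)" "functional (w i)" for i
      using R(1) z by (auto simp: l_def w_def)
    ultimately show ?thesis by (intro inv_form_chain[of l w])
  qed
  show ?thesis using U trans odd unfolding in_list_def V2_def W2_def by blast
qed

lemma inv_form_trivial:
  assumes triv: "\<And>u. u \<in> U \<Longrightarrow> X u = 0" "\<And>u. u \<in> U \<Longrightarrow> Y u = 0"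
    and pr: "\<And>x y. pr (x + y) = pr x + pr y" "\<And>c x. pr (scale c x) = scale c (pr x)"
      "\<And>x. pr x \<in> U" "\<And>x. pr (s1 x) = s1 (pr x)" "\<And>x. pr (s2 x) = s2 (pr x)"
    and x: "pr x \<noteq> 0"
  shows "\<exists>f. inv_form 1 f \<and> f x \<noteq> 0"
proof -
  obtain f where f: "functional f" "f (pr x) = 1" using functional_nonzero[OF x] by blast
  have "functional (\<lambda>x. f (pr x))" using f pr by (simp add: functional_iff)
  moreover have "s1 (pr y) = pr y" "s2 (pr y) = pr y" for y
    using triv[OF pr(3)] by (simp_all add: s1_eq s2_eq)
  ultimately have "inv_form 1 (\<lambda>x. f (pr x))"
    unfolding inv_form_def homogeneous_poly_1_iff by (simp add: pr)
  then show ?thesis using f by (intro exI[of _ "\<lambda>x. f (pr x)"]) simp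
qed

subsection \<open>Decomposition and conclusion\<close>

lemma projections:
  fixes U :: "nat \<Rightarrow> 'v set" and k :: nat
  assumes st: "\<forall>i<k. stable (U i)"
    and dec: "\<And>v. \<exists>!u. u \<in> (\<Pi>\<^sub>E i\<in>{..<k}. U i) \<and> v = (\<Sum>i<k. u i)"
  shows "\<exists>pr. (\<forall>i<k. \<forall>x y. pr i (x + y) = pr i x + pr i y) \<and>
    (\<forall>i<k. \<forall>c x. pr i (scale c x) = scale c (pr i x)) \<and> (\<forall>i<k. \<forall>x. pr i x \<in> U i) \<and>
    (\<forall>i<k. \<forall>x. pr i (s1 x) = s1 (pr i x)) \<and> (\<forall>i<k. \<forall>x. pr i (s2 x) = s2 (pr i x)) \<and>
    (\<forall>x. x = (\<Sum>i<k. pr i x))"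
proof -
  define D where "D v = (THE u. u \<in> (\<Pi>\<^sub>E i\<in>{..<k}. U i) \<and> v = (\<Sum>i<k. u i))" for v
  have D: "D v \<in> (\<Pi>\<^sub>E i\<in>{..<k}. U i) \<and> v = (\<Sum>i<k. D v i)" for v
    unfolding D_def by (rule theI'[OF dec])
  have DU: "D v i \<in> U i" if "i < k" for v i using D[of v] that by (auto dest: PiE_mem)
  \<comment> \<open>Linearity and equivariance of the components all follow from uniqueness of the
    decomposition. \<open>restrict\<close> supplies the default value that the extensional function
    space demands outside the index set.\<close>
  have uniq: "D v i = u i" if u: "\<And>i. i < k \<Longrightarrow> u i \<in> U i" "v = (\<Sum>i<k. u i)" and i: "i < k"
    for v u i
  proof -
    have "D v = restrict u {..<k}"
      using u unfolding D_def by (intro the1_equality[OF dec]) auto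
    then show ?thesis using i by simp
  qed
  have sub: "subspace (U i)" if "i < k" for i using st that by (simp add: stable_def)
  have s1U: "s1 x \<in> U i" and s2U: "s2 x \<in> U i" if "i < k" "x \<in> U i" for i x
    using st that by (auto simp: stable_def)
  have sum_s: "s1 (sum g A) = (\<Sum>x\<in>A. s1 (g x))" "s2 (sum g A) = (\<Sum>x\<in>A. s2 (g x))"
    for g and A :: "nat set"
    by (induction A rule: infinite_finite_induct) auto
  have sumD: "(\<Sum>i<k. D v i) = v" for v using D by metis
  show ?thesis
  proof (intro exI[of _ "\<lambda>i v. D v i"] conjI allI impI)
    show "D (x + y) i = D x i + D y i" if "i < k" for i x y
      by (rule uniq[where u = "\<lambda>i. D x i + D y i"])
         (use that DU in \<open>auto simp: sum.distrib sumD intro: subspace_add sub\<close>)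
    show "D (scale c x) i = scale c (D x i)" if "i < k" for i c x
      by (rule uniq[where u = "\<lambda>i. scale c (D x i)"])
         (use that DU in \<open>auto simp: sumD simp flip: scale_sum_right intro: subspace_scale sub\<close>)
    show "D x i \<in> U i" if "i < k" for i x using DU that by blast
    show "D (s1 x) i = s1 (D x i)" if "i < k" for i x
      by (rule uniq[where u = "\<lambda>i. s1 (D x i)"])
         (use that DU s1U sum_s(1)[of "D x" "{..<k}"] in \<open>auto simp: sumD\<close>)
    show "D (s2 x) i = s2 (D x i)" if "i < k" for i x
      by (rule uniq[where u = "\<lambda>i. s2 (D x i)"])
         (use that DU s2U sum_s(2)[of "D x" "{..<k}"] in \<open>auto simp: sumD\<close>)
    show "x = (\<Sum>i<k. D x i)" for x by (simp add: sumD)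
  qed
qed

end

text \<open>Properties closed under composition pass from the generators to the whole group.
  Inverses of generators add no case, since every element is its own inverse.\<close>

lemma klein_induct:
  assumes G: "klein_four_group G \<sigma>1 \<sigma>2" and rep: "representation G scale \<rho>" and g: "g \<in> carrier G"
    and Q: "Q id" "Q (\<rho> \<sigma>1)" "Q (\<rho> \<sigma>2)" "\<And>a b. Q a \<Longrightarrow> Q b \<Longrightarrow> Q (a \<circ> b)"
  shows "Q (\<rho> g)"
proof -
  interpret group G using G by (simp add: klein_four_group_def)
  have gen: "generate G {\<sigma>1, \<sigma>2} = carrier G" and sq: "\<And>h. h \<in> carrier G \<Longrightarrow> h \<otimes>\<^bsub>G\<^esub> h = \<one>\<^bsub>G\<^esub>"
    and \<sigma>: "\<sigma>1 \<in> carrier G" "\<sigma>2 \<in> carrier G"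
    using G by (auto simp: klein_four_group_def)
  have "g \<in> generate G {\<sigma>1, \<sigma>2}" using g gen by simp
  then show ?thesis
  proof (induction rule: generate.induct)
    case one
    have "\<rho> \<one>\<^bsub>G\<^esub> = id" using rep by (simp add: Defs.representation_def)
    then show ?case using Q(1) by (simp only:)
  next
    case (incl h)
    then show ?case using Q by auto
  next
    case (inv h)
    then have "inv\<^bsub>G\<^esub> h = h" using sq \<sigma> by (intro inv_equality) auto
    then show ?case using inv Q by auto
  next
    case (eng h1 h2)
    then have "\<rho> (h1 \<otimes>\<^bsub>G\<^esub> h2) = \<rho> h1 \<circ> \<rho> h2" using rep gen by (auto simp: Defs.representation_def)
    then show ?case using eng Q(4) by (simp only:)
  qed
qed

lemma klein_rep_intro:
  fixes scale :: "'a::alg_closed_field \<Rightarrow> 'v::ab_group_add \<Rightarrow> 'v"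
  assumes "CHAR('a) = 2" and G: "klein_four_group G \<sigma>1 \<sigma>2" and rep: "representation G scale \<rho>"
  shows "klein_rep scale \<rho> \<sigma>1 \<sigma>2"
proof -
  interpret G: group G using G by (simp add: klein_four_group_def)
  interpret vector_space scale using rep by (simp add: Defs.representation_def)
  have \<sigma>: "\<sigma>1 \<in> carrier G" "\<sigma>2 \<in> carrier G"
    and sq: "\<And>h. h \<in> carrier G \<Longrightarrow> h \<otimes>\<^bsub>G\<^esub> h = \<one>\<^bsub>G\<^esub>"
    using G by (auto simp: klein_four_group_def)
  have \<rho>: "\<rho> \<one>\<^bsub>G\<^esub> = id"
    "\<And>g h. g \<in> carrier G \<Longrightarrow> h \<in> carrier G \<Longrightarrow> \<rho> (g \<otimes>\<^bsub>G\<^esub> h) = \<rho> g \<circ> \<rho> h"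
    using rep by (auto simp: Defs.representation_def)
  have "inv\<^bsub>G\<^esub> h = h" if "h \<in> carrier G" for h
    using sq that by (intro G.inv_equality) auto
  then have comm: "\<sigma>1 \<otimes>\<^bsub>G\<^esub> \<sigma>2 = \<sigma>2 \<otimes>\<^bsub>G\<^esub> \<sigma>1"
    using \<sigma> G.inv_mult_group[of \<sigma>1 \<sigma>2] by simp
  have comm: "\<rho> \<sigma>1 \<circ> \<rho> \<sigma>2 = \<rho> \<sigma>2 \<circ> \<rho> \<sigma>1"
    using \<rho>(2)[OF \<sigma>] \<rho>(2)[OF \<sigma>(2,1)] comm by simp
  have invol: "\<rho> h \<circ> \<rho> h = id" if "h \<in> carrier G" for h
    using \<rho>(2)[OF that that] sq[OF that] \<rho>(1) by simp
  show ?thesis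
  proof (intro klein_rep.intro klein_rep_axioms.intro)
    show "vector_space scale" by (fact vector_space_axioms)
    show "(2::'a) = 0" using of_nat_CHAR[where 'a = 'a] assms(1) by simp
    show "Vector_Spaces.linear scale scale (\<rho> \<sigma>1)" "Vector_Spaces.linear scale scale (\<rho> \<sigma>2)"
      using rep \<sigma> by (auto simp: Defs.representation_def)
    show "\<rho> \<sigma>1 (\<rho> \<sigma>1 x) = x" "\<rho> \<sigma>2 (\<rho> \<sigma>2 x) = x" for x
      using invol[OF \<sigma>(1)] invol[OF \<sigma>(2)] by (metis comp_apply id_apply)+
    show "\<rho> \<sigma>1 (\<rho> \<sigma>2 x) = \<rho> \<sigma>2 (\<rho> \<sigma>1 x)" for x using comm by (metis comp_apply)
    show "\<exists>B. finite B \<and> span B = UNIV" using rep by (simp add: Defs.representation_def)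
  qed
qed

theorem theorem15:
  fixes scale :: "'a::alg_closed_field \<Rightarrow> 'v::ab_group_add \<Rightarrow> 'v"
    and G :: "('g, 'm) monoid_scheme" and \<sigma>1 \<sigma>2 :: 'g
    and \<rho> :: "'g \<Rightarrow> 'v \<Rightarrow> 'v"
    and k :: nat and U :: "nat \<Rightarrow> 'v set"
  assumes "CHAR('a) = 2"
    and "klein_four_group G \<sigma>1 \<sigma>2"
    and "representation G scale \<rho>"
    and "nontrivial_on G \<rho> UNIV"
    and "indecomposable_decomposition G scale \<rho> k U"
  shows "((delta G scale \<rho> = 2 \<and> gamma G scale \<rho> = 2) \<longleftrightarrow>
            (\<forall>i<k. nontrivial_on G \<rho> (U i) \<longrightarrow> in_list scale \<rho> \<sigma>1 \<sigma>2 (U i))) \<and>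
         ((\<exists>i<k. nontrivial_on G \<rho> (U i) \<and> \<not> in_list scale \<rho> \<sigma>1 \<sigma>2 (U i)) \<longrightarrow>
            delta G scale \<rho> = 4 \<and> gamma G scale \<rho> = 4)"
proof -
  interpret klein_rep scale \<rho> \<sigma>1 \<sigma>2 by (rule klein_rep_intro[OF assms(1-3)])
  note induct = klein_induct[OF assms(2,3)]
  interpret G: group G using assms(2) by (simp add: klein_four_group_def)
  have \<sigma>: "\<sigma>1 \<in> carrier G" "\<sigma>2 \<in> carrier G"
    using assms(2) by (auto simp: klein_four_group_def)
  have inv_\<sigma>: "inv\<^bsub>G\<^esub> \<sigma>1 = \<sigma>1" "inv\<^bsub>G\<^esub> \<sigma>2 = \<sigma>2"
    using assms(2) \<sigma> by (auto simp: klein_four_group_def intro!: G.inv_equality)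
  have subrep: "subrep G scale \<rho> A \<longleftrightarrow> stable A" for A
  proof
    assume "stable A"
    then have "\<rho> g ` A \<subseteq> A" if "g \<in> carrier G" for g
      by (intro induct[OF that, of "\<lambda>a. a ` A \<subseteq> A"]) (auto simp: stable_def)
    with \<open>stable A\<close> show "subrep G scale \<rho> A" by (simp add: subrep_def stable_def)
  qed (use \<sigma> in \<open>auto simp: subrep_def stable_def\<close>)
  have indec: "indecomposable G scale \<rho> A \<longleftrightarrow> indec A" for A
    by (simp add: indecomposable_def indec_def subrep)
  have fixed: "v \<in> fixed_points G \<rho> \<longleftrightarrow> s1 v = v \<and> s2 v = v" for v
  proof
    assume "s1 v = v \<and> s2 v = v"
    then have "\<rho> g v = v" if "g \<in> carrier G" for g
      by (intro induct[OF that, of "\<lambda>a. a v = v"]) auto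
    then show "v \<in> fixed_points G \<rho>" by (simp add: fixed_points_def)
  qed (use \<sigma> in \<open>auto simp: fixed_points_def\<close>)
  have nontrivial: "nontrivial_on G \<rho> A \<longleftrightarrow> (\<exists>u\<in>A. X u \<noteq> 0 \<or> Y u \<noteq> 0)" for A
  proof -
    have "(\<exists>g\<in>carrier G. \<rho> g u \<noteq> u) \<longleftrightarrow> \<not> (s1 u = u \<and> s2 u = u)" for u
      using fixed[of u] by (auto simp: fixed_points_def)
    then show ?thesis unfolding nontrivial_on_def X_def Y_def add_eq_0_v by blast
  qed
  have invariants: "f \<in> invariants G scale \<rho> d \<longleftrightarrow> inv_form d f" for f d
  proof
    assume f: "f \<in> invariants G scale \<rho> d"
    then have "f \<circ> \<rho> (inv\<^bsub>G\<^esub> \<sigma>1) = f" "f \<circ> \<rho> (inv\<^bsub>G\<^esub> \<sigma>2) = f"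
      using \<sigma> unfolding invariants_def by blast+
    then show "inv_form d f"
      using f by (auto simp: invariants_def inv_form_def inv_\<sigma> fun_eq_iff)
  next
    assume f: "inv_form d f"
    have "f \<circ> \<rho> (inv\<^bsub>G\<^esub> g) = f" if "g \<in> carrier G" for g
    proof (rule induct[of "inv\<^bsub>G\<^esub> g" "\<lambda>a. f \<circ> a = f"])
      show "f \<circ> (a \<circ> b) = f" if "f \<circ> a = f" "f \<circ> b = f" for a b
        using that by (simp add: o_assoc)
    qed (use that f in \<open>auto simp: inv_form_def fun_eq_iff\<close>)
    then show "f \<in> invariants G scale \<rho> d" using f by (simp add: invariants_def inv_form_def)
  qed
  have eps: "epsilon G scale \<rho> v = Inf {enat d |d. 0 < d \<and> (\<exists>f. inv_form d f \<and> f v \<noteq> 0)}" for v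
    by (simp add: epsilon_def Bex_def invariants)
  have eps_le: "epsilon G scale \<rho> v \<le> enat d" if "0 < d" "inv_form d f" "f v \<noteq> 0" for v d f
    unfolding eps using that by (intro Inf_lower CollectI exI[of _ d] conjI exI[of _ f] refl)
  have eps_ge: "enat c \<le> epsilon G scale \<rho> v"
    if "\<And>d f. 0 < d \<Longrightarrow> d < c \<Longrightarrow> inv_form d f \<Longrightarrow> f v = 0" for v c
    unfolding eps
  proof (intro Inf_greatest)
    fix e assume "e \<in> {enat d |d. 0 < d \<and> (\<exists>f. inv_form d f \<and> f v \<noteq> 0)}"
    then obtain d f where "e = enat d" "0 < d" "inv_form d f" "f v \<noteq> 0" by blast
    then show "enat c \<le> e" using that[of d f] by (metis enat_ord_simps(1) not_le)
  qed
  have gamma_le: "gamma G scale \<rho> \<le> c" if "\<And>v. v \<noteq> 0 \<Longrightarrow> epsilon G scale \<rho> v \<le> c" for c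
    unfolding gamma_def using that by (intro SUP_least) auto
  have delta_ge: "c \<le> delta G scale \<rho>"
    if "s1 v = v" "s2 v = v" "v \<noteq> 0" "c \<le> epsilon G scale \<rho> v" for v c
  proof -
    have v: "v \<in> fixed_points G \<rho> - {0}" using that fixed by simp
    then have "fixed_points G \<rho> \<noteq> {0}" by blast
    then show ?thesis
      unfolding delta_def using that(4) SUP_upper[OF v, of "epsilon G scale \<rho>"] by auto
  qed
  have delta_le: "delta G scale \<rho> \<le> gamma G scale \<rho>"
    unfolding delta_def gamma_def by (auto intro!: SUP_subset_mono)
  \<comment> \<open>This reduces each pair of values to a lower bound for \<open>delta\<close> and
    an upper bound for \<open>gamma\<close>.\<close>
  have eq: "delta G scale \<rho> = c \<and> gamma G scale \<rho> = c" if "c \<le> delta G scale \<rho>" "gamma G scale \<rho> \<le> c" for c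
    using that delta_le by (meson order_antisym order_trans)
  have gamma_4: "gamma G scale \<rho> \<le> 4"
  proof (rule gamma_le)
    fix v :: 'v assume "v \<noteq> 0"
    then obtain f where "inv_form 4 f" "f v \<noteq> 0" using exists_inv_form_4 by blast
    then show "epsilon G scale \<rho> v \<le> 4" using eps_le[of 4 f v] by (simp add: numeral_eq_enat)
  qed
  have delta_2: "2 \<le> delta G scale \<rho>"
  proof -
    \<comment> \<open>Invariant linear forms vanish on the images of \<open>X\<close> and
      \<open>Y\<close>, so a nonzero fixed vector there has \<open>epsilon\<close> at least 2. If
      some \<open>X (Y x)\<close> is nonzero, it is such a vector; otherwise both images consist of
      fixed vectors.\<close>
    have "\<exists>v x. v \<noteq> 0 \<and> s1 v = v \<and> s2 v = v \<and> (v = X x \<or> v = Y x)"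
    proof (cases "\<exists>x. X (Y x) \<noteq> 0")
      case True
      then obtain x where "X (Y x) \<noteq> 0" by blast
      moreover have "Y (X (Y x)) = 0" by (simp flip: X_Y)
      ultimately show ?thesis
        by (intro exI[of _ "X (Y x)"] exI[of _ "Y x"]) (simp add: s1_eq s2_eq)
    next
      case False
      obtain x where "X x \<noteq> 0 \<or> Y x \<noteq> 0" using assms(4) nontrivial by blast
      then show ?thesis
      proof
        assume "X x \<noteq> 0"
        then show ?thesis using False X_Y[of x]
          by (intro exI[of _ "X x"] exI[of _ x]) (simp add: s1_eq s2_eq)
      next
        assume "Y x \<noteq> 0"
        then show ?thesis using False
          by (intro exI[of _ "Y x"] exI[of _ x]) (simp add: s1_eq s2_eq)
      qed
    qed
    then obtain v x where v: "v \<noteq> 0" "s1 v = v" "s2 v = v" "v = X x \<or> v = Y x" by blast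
    have "enat 2 \<le> epsilon G scale \<rho> v"
    proof (rule eps_ge)
      fix d f assume d: "0 < d" "d < 2" and f: "inv_form d f"
      have "d = 1" using d by linarith
      then show "f v = 0" using f v(4) inv_form_1_vanishes by blast
    qed
    then show ?thesis using delta_ge[OF v(2,3,1)] by (simp add: numeral_eq_enat)
  qed
  have U: "indec (U i)" if "i < k" for i
    using assms(5) that by (simp add: indecomposable_decomposition_def indec)
  have good: "delta G scale \<rho> = 2 \<and> gamma G scale \<rho> = 2"
    if list: "\<forall>i<k. nontrivial_on G \<rho> (U i) \<longrightarrow> in_list scale \<rho> \<sigma>1 \<sigma>2 (U i)"
  proof (rule eq[OF delta_2 gamma_le])
    fix v :: 'v assume "v \<noteq> 0"
    have st: "\<forall>i<k. stable (U i)" using U by (simp add: indec_def)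
    have dec: "\<exists>!u. u \<in> (\<Pi>\<^sub>E i\<in>{..<k}. U i) \<and> v = (\<Sum>i<k. u i)" for v
      using assms(5) by (simp add: indecomposable_decomposition_def)
    from projections[of k U, OF st dec]
    obtain pr where pr: "\<forall>i<k. \<forall>x y. pr i (x + y) = pr i x + pr i y"
      "\<forall>i<k. \<forall>c x. pr i (scale c x) = scale c (pr i x)" "\<forall>i<k. \<forall>x. pr i x \<in> U i"
      "\<forall>i<k. \<forall>x. pr i (s1 x) = s1 (pr i x)" "\<forall>i<k. \<forall>x. pr i (s2 x) = s2 (pr i x)"
      and sum: "\<forall>x. x = (\<Sum>i<k. pr i x)"
      by (elim exE conjE)
    obtain i where i: "i < k" "pr i v \<noteq> 0"
    proof (rule ccontr)
      assume "\<not> thesis"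
      then have "(\<Sum>i<k. pr i v) = 0" using that by (intro sum.neutral) blast
      then show False using spec[OF sum, of v] \<open>v \<noteq> 0\<close> by simp
    qed
    have "\<exists>d\<in>{1,2}. \<exists>f. inv_form d f \<and> f v \<noteq> 0"
    proof (cases "nontrivial_on G \<rho> (U i)")
      case True
      then have "in_list scale \<rho> \<sigma>1 \<sigma>2 (U i)" using list i by blast
      then show ?thesis
        by (rule inv_form_in_list[where pr = "pr i"])
           (use st pr i in \<open>auto simp: stable_def\<close>)
    next
      case False
      then have "\<exists>f. inv_form 1 f \<and> f v \<noteq> 0"
        by (intro inv_form_trivial[where pr = "pr i" and U = "U i"])
           (use pr i in \<open>auto simp: nontrivial\<close>)
      then show ?thesis by blast
    qed
    then obtain d f where "d \<in> {1, 2}" "inv_form d f" "f v \<noteq> 0" by blast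
    then have "epsilon G scale \<rho> v \<le> enat d" "enat d \<le> enat 2" using eps_le[of d f v] by auto
    then show "epsilon G scale \<rho> v \<le> 2" by (metis numeral_eq_enat order_trans)
  qed
  have bad: "delta G scale \<rho> = 4 \<and> gamma G scale \<rho> = 4"
    if ex: "\<exists>i<k. nontrivial_on G \<rho> (U i) \<and> \<not> in_list scale \<rho> \<sigma>1 \<sigma>2 (U i)"
  proof (rule eq[OF _ gamma_4])
    obtain i where i: "i < k" "nontrivial_on G \<rho> (U i)" "\<not> in_list scale \<rho> \<sigma>1 \<sigma>2 (U i)"
      using ex by blast
    have "\<exists>v. v \<noteq> 0 \<and> X v = 0 \<and> Y v = 0 \<and> (\<forall>q. quad_inv q \<longrightarrow> q v = 0)"
    proof (rule ccontr)
      assume no: "\<not> ?thesis"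
      have "in_list scale \<rho> \<sigma>1 \<sigma>2 (U i)"
        by (rule in_list_if_quadratics_separate[OF U[OF i(1)]])
           (use i(2) nontrivial no in blast)+
      then show False using i(3) by blast
    qed
    then obtain v where v: "v \<noteq> 0" "X v = 0" "Y v = 0" "\<And>q. quad_inv q \<Longrightarrow> q v = 0" by blast
    have s: "s1 v = v" "s2 v = v" using v by (simp_all add: s1_eq s2_eq)
    have "enat 4 \<le> epsilon G scale \<rho> v"
    proof (rule eps_ge)
      fix d f assume "0 < d" "d < 4" "inv_form d f"
      then show "f v = 0" by (rule inv_form_le_3_vanishes[rotated 3]) (use s v(4) in auto)
    qed
    then show "4 \<le> delta G scale \<rho>" using delta_ge[OF s v(1)] by (simp add: numeral_eq_enat)
  qed
  show ?thesis
  proof (cases "\<forall>i<k. nontrivial_on G \<rho> (U i) \<longrightarrow> in_list scale \<rho> \<sigma>1 \<sigma>2 (U i)")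
    case True
    then show ?thesis using good[OF True] by blast
  next
    case False
    then have "delta G scale \<rho> = 4 \<and> gamma G scale \<rho> = 4" using bad by blast
    \<comment> \<open>As 4 differs from 2, both sides of the equivalence are false here.\<close>
    then show ?thesis using False by (simp add: numeral_eq_enat)
  qed
qed

end
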